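(* Let $A$ be a Frobenius algebra over a field $\Bbbk$ with non-degenerate and associative bilinear form $\langle-,-\rangle$ and corresponding Nakayama automorphism $\sigma:A\to A$, let $G$ be a finite group with identity $e$ acting on $A$ by algebra automorphisms, and let $\alpha:G\times G\to\Bbbk^\times$ be a $2$-cocycle on $G$. There is a non-degenerate and associative bilinear form $\langle\langle-,-\rangle\rangle:A\#_\alpha G\times A\#_\alpha G\to\Bbbk$ on the twisted crossed product algebra $A\#_\alpha G$ that has $$\langle\langle a\#g,b\#h\rangle\rangle=\alpha(g,h)\cdot\langle a,g(b)\rangle\cdot\delta_{gh,e}$$ for all $a,b\in A$ and all $g,h\in G$, and the Nakayama automorphism $\Sigma:A\#_\alpha G\to A\#_\alpha G$ that corresponds to it has $$\Sigma(a\#g)=\frac{\alpha(g,g^{-1})}{\alpha(g^{-1},g)}\cdot\bigl(\sigma(a)\cdot g(\sigma(\mathrm{jac}_\sigma(g)))\bigr)\#g$$ for all $a\in A$ and all $g\in G$.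
   Context: $\Bbbk$ is a field; algebras are associative and unital over $\Bbbk$. A Frobenius algebra is a finite-dimensional algebra $A$ endowed with a non-degenerate bilinear form $\langle-,-\rangle:A\times A\to\Bbbk$ that is associative: $\langle ab,c\rangle=\langle a,bc\rangle$. The Nakayama automorphism corresponding to such a form is the unique algebra automorphism $\sigma$ such that $\langle a,b\rangle=\langle b,\sigma(a)\rangle$ for all $a,b$. For an algebra automorphism $u$ of $A$, the Nakayama Jacobian $\mathrm{jac}_\sigma(u)$ is the unique element of $A$ with $\langle u(a),u(b)\rangle=\langle\mathrm{jac}_\sigma(u)\cdot a,b\rangle$ for all $a,b\in A$; for $g\in G$, $\mathrm{jac}_\sigma(g)$ is the Jacobian of the automorphism $a\mapsto g(a)$. A $2$-cocycle is a function $\alpha:G\times G\to\Bbbk^\times$ with $\alpha(h,k)\,\alpha(g,hk)=\alpha(gh,k)\,\alpha(g,h)$ for all $g,h,k\in G$ (not necessarily normalized). The twisted crossed product $A\#_\alpha G$ is the free left $A$-module on the set $G$, with monomials written $a\#g$, and with multiplication $a\#g\cdot b\#h=\alpha(g,h)\cdot a\,g(b)\#gh$; it is an associative algebra with unit $\alpha(e,e)^{-1}\cdot1_A\#e$. *)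

theory Defs
  imports
    "HOL-Algebra.QuotRing"
    "HOL-Algebra.Group_Action"
    "Jordan_Normal_Form.Missing_VectorSpace"
begin

text \<open>
  Associative unital algebras over a field. The library locale \<open>algebra\<close> is not usable
  here, since it requires the algebra to be commutative.
\<close>

locale assoc_algebra = vectorspace K A + A: ring A for K and A (structure) +
  assumes smult_mult_left:
      "\<lbrakk> c \<in> carrier K; x \<in> carrier A; y \<in> carrier A \<rbrakk>
        \<Longrightarrow> (c \<odot> x) \<otimes> y = c \<odot> (x \<otimes> y)"
    and smult_mult_right:
      "\<lbrakk> c \<in> carrier K; x \<in> carrier A; y \<in> carrier A \<rbrakk>
        \<Longrightarrow> x \<otimes> (c \<odot> y) = c \<odot> (x \<otimes> y)"

definition algebra_automorphism ::
  "('k, 'm) ring_scheme \<Rightarrow> ('k, 'a, 'n) module_scheme \<Rightarrow> ('a \<Rightarrow> 'a) \<Rightarrow> bool"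
  where "algebra_automorphism K A u \<longleftrightarrow>
    u \<in> ring_iso A A \<and>
    (\<forall>c\<in>carrier K. \<forall>x\<in>carrier A. u (c \<odot>\<^bsub>A\<^esub> x) = c \<odot>\<^bsub>A\<^esub> u x)"

definition bilinear_form ::
  "('k, 'm) ring_scheme \<Rightarrow> ('k, 'a, 'n) module_scheme \<Rightarrow> ('a \<Rightarrow> 'a \<Rightarrow> 'k) \<Rightarrow> bool"
  where "bilinear_form K A B \<longleftrightarrow>
    (\<forall>x\<in>carrier A. \<forall>y\<in>carrier A. B x y \<in> carrier K) \<and>
    (\<forall>x\<in>carrier A. \<forall>y\<in>carrier A. \<forall>z\<in>carrier A.
       B (x \<oplus>\<^bsub>A\<^esub> y) z = B x z \<oplus>\<^bsub>K\<^esub> B y z \<and>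
       B x (y \<oplus>\<^bsub>A\<^esub> z) = B x y \<oplus>\<^bsub>K\<^esub> B x z) \<and>
    (\<forall>c\<in>carrier K. \<forall>x\<in>carrier A. \<forall>y\<in>carrier A.
       B (c \<odot>\<^bsub>A\<^esub> x) y = c \<otimes>\<^bsub>K\<^esub> B x y \<and>
       B x (c \<odot>\<^bsub>A\<^esub> y) = c \<otimes>\<^bsub>K\<^esub> B x y)"

definition nondegenerate_form ::
  "('k, 'm) ring_scheme \<Rightarrow> ('k, 'a, 'n) module_scheme \<Rightarrow> ('a \<Rightarrow> 'a \<Rightarrow> 'k) \<Rightarrow> bool"
  where "nondegenerate_form K A B \<longleftrightarrow>
    (\<forall>x\<in>carrier A. (\<forall>y\<in>carrier A. B x y = \<zero>\<^bsub>K\<^esub>) \<longrightarrow> x = \<zero>\<^bsub>A\<^esub>) \<and>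
    (\<forall>y\<in>carrier A. (\<forall>x\<in>carrier A. B x y = \<zero>\<^bsub>K\<^esub>) \<longrightarrow> y = \<zero>\<^bsub>A\<^esub>)"

definition associative_form ::
  "('k, 'a, 'n) module_scheme \<Rightarrow> ('a \<Rightarrow> 'a \<Rightarrow> 'k) \<Rightarrow> bool"
  where "associative_form A B \<longleftrightarrow>
    (\<forall>x\<in>carrier A. \<forall>y\<in>carrier A. \<forall>z\<in>carrier A.
       B (x \<otimes>\<^bsub>A\<^esub> y) z = B x (y \<otimes>\<^bsub>A\<^esub> z))"

definition frobenius_algebra ::
  "('k, 'm) ring_scheme \<Rightarrow> ('k, 'a, 'n) module_scheme \<Rightarrow> ('a \<Rightarrow> 'a \<Rightarrow> 'k) \<Rightarrow> bool"
  where "frobenius_algebra K A B \<longleftrightarrow>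
    assoc_algebra K A \<and> vectorspace.fin_dim K A \<and>
    bilinear_form K A B \<and> nondegenerate_form K A B \<and> associative_form A B"

definition nakayama_automorphism ::
  "('k, 'm) ring_scheme \<Rightarrow> ('k, 'a, 'n) module_scheme \<Rightarrow> ('a \<Rightarrow> 'a \<Rightarrow> 'k) \<Rightarrow> ('a \<Rightarrow> 'a) \<Rightarrow> bool"
  where "nakayama_automorphism K A B \<sigma> \<longleftrightarrow>
    algebra_automorphism K A \<sigma> \<and>
    (\<forall>x\<in>carrier A. \<forall>y\<in>carrier A. B x y = B y (\<sigma> x))"

definition nakayama_jacobian ::
  "('k, 'a, 'n) module_scheme \<Rightarrow> ('a \<Rightarrow> 'a \<Rightarrow> 'k) \<Rightarrow> ('a \<Rightarrow> 'a) \<Rightarrow> 'a"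
  where "nakayama_jacobian A B u =
    (THE j. j \<in> carrier A \<and>
       (\<forall>x\<in>carrier A. \<forall>y\<in>carrier A. B (u x) (u y) = B (j \<otimes>\<^bsub>A\<^esub> x) y))"

definition acts_by_algebra_automorphisms ::
  "('k, 'm) ring_scheme \<Rightarrow> ('k, 'a, 'n) module_scheme \<Rightarrow> ('g, 'p) monoid_scheme \<Rightarrow>
   ('g \<Rightarrow> 'a \<Rightarrow> 'a) \<Rightarrow> bool"
  where "acts_by_algebra_automorphisms K A G \<phi> \<longleftrightarrow>
    group_action G (carrier A) \<phi> \<and>
    (\<forall>g\<in>carrier G. algebra_automorphism K A (\<phi> g))"

definition two_cocycle ::
  "('k, 'm) ring_scheme \<Rightarrow> ('g, 'p) monoid_scheme \<Rightarrow> ('g \<Rightarrow> 'g \<Rightarrow> 'k) \<Rightarrow> bool"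
  where "two_cocycle K G \<alpha> \<longleftrightarrow>
    (\<forall>g\<in>carrier G. \<forall>h\<in>carrier G. \<alpha> g h \<in> Units K) \<and>
    (\<forall>g\<in>carrier G. \<forall>h\<in>carrier G. \<forall>k\<in>carrier G.
       \<alpha> h k \<otimes>\<^bsub>K\<^esub> \<alpha> g (h \<otimes>\<^bsub>G\<^esub> k) = \<alpha> (g \<otimes>\<^bsub>G\<^esub> h) k \<otimes>\<^bsub>K\<^esub> \<alpha> g h)"

text \<open>
  For finite \<open>G\<close>, the free left \<open>A\<close>-module on \<open>carrier G\<close> is the set of all coefficient
  functions \<open>x\<close> from \<open>carrier G\<close> to \<open>carrier A\<close>, the function \<open>x\<close> standing for the sum
  of the monomials \<open>x g # g\<close>. The element \<open>monomial A G a g\<close> is \<open>a # g\<close>.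
\<close>

definition monomial ::
  "('k, 'a, 'n) module_scheme \<Rightarrow> ('g, 'p) monoid_scheme \<Rightarrow> 'a \<Rightarrow> 'g \<Rightarrow> 'g \<Rightarrow> 'a"
  where "monomial A G a g = (\<lambda>k\<in>carrier G. if k = g then a else \<zero>\<^bsub>A\<^esub>)"

text \<open>
  The coefficient of a product at \<open>k\<close> collects the terms
  \<open>x g # g \<cdot> y h # h = \<alpha> g h (x g \<cdot> \<phi> g (y h)) # gh\<close> with \<open>gh = k\<close>.
\<close>

definition twisted_crossed_product ::
  "('k, 'm) ring_scheme \<Rightarrow> ('k, 'a, 'n) module_scheme \<Rightarrow> ('g, 'p) monoid_scheme \<Rightarrow>
   ('g \<Rightarrow> 'a \<Rightarrow> 'a) \<Rightarrow> ('g \<Rightarrow> 'g \<Rightarrow> 'k) \<Rightarrow> ('k, 'g \<Rightarrow> 'a) module"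
  where "twisted_crossed_product K A G \<phi> \<alpha> = \<lparr>
    carrier = carrier G \<rightarrow>\<^sub>E carrier A,
    mult = (\<lambda>x y. \<lambda>k\<in>carrier G.
      \<Oplus>\<^bsub>A\<^esub>g\<in>carrier G.
        \<alpha> g (inv\<^bsub>G\<^esub> g \<otimes>\<^bsub>G\<^esub> k) \<odot>\<^bsub>A\<^esub> (x g \<otimes>\<^bsub>A\<^esub> \<phi> g (y (inv\<^bsub>G\<^esub> g \<otimes>\<^bsub>G\<^esub> k)))),
    one = monomial A G (inv\<^bsub>K\<^esub> (\<alpha> \<one>\<^bsub>G\<^esub> \<one>\<^bsub>G\<^esub>) \<odot>\<^bsub>A\<^esub> \<one>\<^bsub>A\<^esub>) \<one>\<^bsub>G\<^esub>,
    zero = (\<lambda>k\<in>carrier G. \<zero>\<^bsub>A\<^esub>),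
    add = (\<lambda>x y. \<lambda>k\<in>carrier G. x k \<oplus>\<^bsub>A\<^esub> y k),
    smult = (\<lambda>c x. \<lambda>k\<in>carrier G. c \<odot>\<^bsub>A\<^esub> x k) \<rparr>"


text \<open>
  The structure just defined multiplies monomials by the rule above and is an associative
  unital algebra.
\<close>

locale crossed_product_data = A: assoc_algebra K A + G: Group.group G
  for K (structure) and A and G and \<phi> and \<alpha> +
  assumes fin: "finite (carrier G)"
    and act: "acts_by_algebra_automorphisms K A G \<phi>"
    and coc: "two_cocycle K G \<alpha>"
begin

abbreviation "C \<equiv> twisted_crossed_product K A G \<phi> \<alpha>"

lemma action:
  assumes "g \<in> carrier G"
  shows action_closed: "x \<in> carrier A \<Longrightarrow> \<phi> g x \<in> carrier A"
    and action_mult: "\<lbrakk>x \<in> carrier A; y \<in> carrier A\<rbrakk> \<Longrightarrow> \<phi> g (x \<otimes>\<^bsub>A\<^esub> y) = \<phi> g x \<otimes>\<^bsub>A\<^esub> \<phi> g y"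
    and action_add: "\<lbrakk>x \<in> carrier A; y \<in> carrier A\<rbrakk> \<Longrightarrow> \<phi> g (x \<oplus>\<^bsub>A\<^esub> y) = \<phi> g x \<oplus>\<^bsub>A\<^esub> \<phi> g y"
    and action_one: "\<phi> g \<one>\<^bsub>A\<^esub> = \<one>\<^bsub>A\<^esub>"
    and action_smult: "\<lbrakk>c \<in> carrier K; x \<in> carrier A\<rbrakk> \<Longrightarrow> \<phi> g (c \<odot>\<^bsub>A\<^esub> x) = c \<odot>\<^bsub>A\<^esub> \<phi> g x"
  using act assms
  by (auto simp: acts_by_algebra_automorphisms_def algebra_automorphism_def dest: ring_iso_memE)

lemma action_zero: "g \<in> carrier G \<Longrightarrow> \<phi> g \<zero>\<^bsub>A\<^esub> = \<zero>\<^bsub>A\<^esub>"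
  using action_smult[of g "\<zero>\<^bsub>K\<^esub>" "\<zero>\<^bsub>A\<^esub>"] action_closed[of g "\<zero>\<^bsub>A\<^esub>"] by simp

lemma action_comp:
  "\<lbrakk>g \<in> carrier G; h \<in> carrier G; x \<in> carrier A\<rbrakk> \<Longrightarrow> \<phi> (g \<otimes>\<^bsub>G\<^esub> h) x = \<phi> g (\<phi> h x)"
  using act group_action.composition_rule
  unfolding acts_by_algebra_automorphisms_def by metis

lemma action_id: "x \<in> carrier A \<Longrightarrow> \<phi> \<one>\<^bsub>G\<^esub> x = x"
  using act group_action.id_eq_one[of G "carrier A" \<phi>]
  unfolding acts_by_algebra_automorphisms_def by (metis restrict_apply')

lemma cocycle_unit: "\<lbrakk>g \<in> carrier G; h \<in> carrier G\<rbrakk> \<Longrightarrow> \<alpha> g h \<in> Units K"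
  using coc by (simp add: two_cocycle_def)

lemma cocycle_closed: "\<lbrakk>g \<in> carrier G; h \<in> carrier G\<rbrakk> \<Longrightarrow> \<alpha> g h \<in> carrier K"
  using cocycle_unit by blast

lemma cocycle_eq:
  "\<lbrakk>g \<in> carrier G; h \<in> carrier G; k \<in> carrier G\<rbrakk> \<Longrightarrow>
    \<alpha> h k \<otimes>\<^bsub>K\<^esub> \<alpha> g (h \<otimes>\<^bsub>G\<^esub> k) = \<alpha> (g \<otimes>\<^bsub>G\<^esub> h) k \<otimes>\<^bsub>K\<^esub> \<alpha> g h"
  using coc by (simp add: two_cocycle_def)

lemma action_finsum:
  assumes "g \<in> carrier G" "finite S" "f \<in> S \<rightarrow> carrier A"
  shows "\<phi> g (\<Oplus>\<^bsub>A\<^esub>s\<in>S. f s) = (\<Oplus>\<^bsub>A\<^esub>s\<in>S. \<phi> g (f s))"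
  using assms(2,3)
proof (induction S rule: finite_induct)
  case empty
  then show ?case using action_zero[OF assms(1)] by simp
next
  case (insert a S)
  then show ?case
    using assms(1) by (simp add: Pi_iff action_closed action_add)
qed

lemma finsum_swap:
  assumes "finite S" "finite T" "\<And>s t. \<lbrakk>s \<in> S; t \<in> T\<rbrakk> \<Longrightarrow> f s t \<in> carrier A"
  shows "(\<Oplus>\<^bsub>A\<^esub>s\<in>S. \<Oplus>\<^bsub>A\<^esub>t\<in>T. f s t) = (\<Oplus>\<^bsub>A\<^esub>t\<in>T. \<Oplus>\<^bsub>A\<^esub>s\<in>S. f s t)"
  using assms(1,3)
proof (induction S rule: finite_induct)
  case empty
  then show ?case by simp
next
  case (insert a S)
  have "(\<Oplus>\<^bsub>A\<^esub>t\<in>T. \<Oplus>\<^bsub>A\<^esub>s\<in>insert a S. f s t) = (\<Oplus>\<^bsub>A\<^esub>t\<in>T. f a t \<oplus>\<^bsub>A\<^esub> (\<Oplus>\<^bsub>A\<^esub>s\<in>S. f s t))"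
    using insert by (intro A.M.finsum_cong') (auto simp: Pi_iff)
  also have "\<dots> = (\<Oplus>\<^bsub>A\<^esub>t\<in>T. f a t) \<oplus>\<^bsub>A\<^esub> (\<Oplus>\<^bsub>A\<^esub>t\<in>T. \<Oplus>\<^bsub>A\<^esub>s\<in>S. f s t)"
    using insert by (intro A.M.finsum_addf) (auto simp: Pi_iff)
  finally show ?case using insert by (simp add: Pi_iff)
qed

lemma mult_app:
  "k \<in> carrier G \<Longrightarrow> (x \<otimes>\<^bsub>C\<^esub> y) k = (\<Oplus>\<^bsub>A\<^esub>g\<in>carrier G.
     \<alpha> g (inv\<^bsub>G\<^esub> g \<otimes>\<^bsub>G\<^esub> k) \<odot>\<^bsub>A\<^esub> (x g \<otimes>\<^bsub>A\<^esub> \<phi> g (y (inv\<^bsub>G\<^esub> g \<otimes>\<^bsub>G\<^esub> k))))"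
  by (simp add: twisted_crossed_product_def)

lemma carrier_C: "carrier C = carrier G \<rightarrow>\<^sub>E carrier A"
  by (simp add: twisted_crossed_product_def)

lemma C_ext: "\<lbrakk>x \<in> carrier C; y \<in> carrier C; \<And>k. k \<in> carrier G \<Longrightarrow> x k = y k\<rbrakk> \<Longrightarrow> x = y"
  unfolding carrier_C by (rule PiE_ext)

lemma C_app: "\<lbrakk>x \<in> carrier C; k \<in> carrier G\<rbrakk> \<Longrightarrow> x k \<in> carrier A"
  unfolding carrier_C by (rule PiE_mem)

lemma term_closed:
  "\<lbrakk>x \<in> carrier C; y \<in> carrier C; g \<in> carrier G; k \<in> carrier G\<rbrakk> \<Longrightarrow>
    \<alpha> g (inv\<^bsub>G\<^esub> g \<otimes>\<^bsub>G\<^esub> k) \<odot>\<^bsub>A\<^esub> (x g \<otimes>\<^bsub>A\<^esub> \<phi> g (y (inv\<^bsub>G\<^esub> g \<otimes>\<^bsub>G\<^esub> k))) \<in> carrier A"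
  by (intro A.smult_closed A.A.m_closed action_closed cocycle_closed C_app) auto

lemma mult_C: assumes "x \<in> carrier C" "y \<in> carrier C" shows "x \<otimes>\<^bsub>C\<^esub> y \<in> carrier C"
proof -
  have "(x \<otimes>\<^bsub>C\<^esub> y) k \<in> carrier A" if "k \<in> carrier G" for k
    unfolding mult_app[OF that] by (intro A.M.finsum_closed) (auto intro: term_closed assms that)
  moreover have "(x \<otimes>\<^bsub>C\<^esub> y) k = undefined" if "k \<notin> carrier G" for k
    using that by (simp add: twisted_crossed_product_def)
  ultimately show ?thesis unfolding carrier_C by (intro PiE_I)
qed

lemma monomial_C: "a \<in> carrier A \<Longrightarrow> monomial A G a g \<in> carrier C"
  by (auto simp: carrier_C monomial_def)

lemma monomial_mult:
  assumes "a \<in> carrier A" "b \<in> carrier A" "g \<in> carrier G" "h \<in> carrier G"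
  shows "monomial A G a g \<otimes>\<^bsub>C\<^esub> monomial A G b h =
    monomial A G (\<alpha> g h \<odot>\<^bsub>A\<^esub> (a \<otimes>\<^bsub>A\<^esub> \<phi> g b)) (g \<otimes>\<^bsub>G\<^esub> h)"
proof (rule C_ext)
  show "monomial A G a g \<otimes>\<^bsub>C\<^esub> monomial A G b h \<in> carrier C"
    using assms by (simp add: mult_C monomial_C)
  show "monomial A G (\<alpha> g h \<odot>\<^bsub>A\<^esub> (a \<otimes>\<^bsub>A\<^esub> \<phi> g b)) (g \<otimes>\<^bsub>G\<^esub> h) \<in> carrier C"
    using assms by (intro monomial_C) (simp add: action_closed cocycle_closed)
  fix k assume k: "k \<in> carrier G"
  let ?t = "\<alpha> g (inv\<^bsub>G\<^esub> g \<otimes>\<^bsub>G\<^esub> k) \<odot>\<^bsub>A\<^esub> (a \<otimes>\<^bsub>A\<^esub> \<phi> g (monomial A G b h (inv\<^bsub>G\<^esub> g \<otimes>\<^bsub>G\<^esub> k)))"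
  have tA: "?t \<in> carrier A"
    using assms k by (intro A.smult_closed A.A.m_closed action_closed cocycle_closed C_app[OF monomial_C]) auto
  have "(monomial A G a g \<otimes>\<^bsub>C\<^esub> monomial A G b h) k = (\<Oplus>\<^bsub>A\<^esub>i\<in>carrier G. if g = i then ?t else \<zero>\<^bsub>A\<^esub>)"
    unfolding mult_app[OF k] using assms k tA
    by (intro A.M.finsum_cong')
       (auto simp: monomial_def action_closed action_zero cocycle_closed)
  also have "\<dots> = ?t"
    using A.M.finsum_singleton[OF assms(3) fin, of "\<lambda>_. ?t"] tA by simp
  also have "\<dots> = monomial A G (\<alpha> g h \<odot>\<^bsub>A\<^esub> (a \<otimes>\<^bsub>A\<^esub> \<phi> g b)) (g \<otimes>\<^bsub>G\<^esub> h) k"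
  proof (cases "k = g \<otimes>\<^bsub>G\<^esub> h")
    case True
    then have "inv\<^bsub>G\<^esub> g \<otimes>\<^bsub>G\<^esub> k = h" using assms by (simp add: G.inv_solve_left')
    then show ?thesis using True assms by (simp add: monomial_def)
  next
    case False
    then have "inv\<^bsub>G\<^esub> g \<otimes>\<^bsub>G\<^esub> k \<noteq> h" using assms k by (auto simp: G.inv_solve_left')
    then show ?thesis using False assms k by (simp add: monomial_def action_zero cocycle_closed)
  qed
  finally show "(monomial A G a g \<otimes>\<^bsub>C\<^esub> monomial A G b h) k =
    monomial A G (\<alpha> g h \<odot>\<^bsub>A\<^esub> (a \<otimes>\<^bsub>A\<^esub> \<phi> g b)) (g \<otimes>\<^bsub>G\<^esub> h) k" .
qed


lemma mult_assoc_C: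
  assumes x: "x \<in> carrier C" and y: "y \<in> carrier C" and z: "z \<in> carrier C"
  shows "(x \<otimes>\<^bsub>C\<^esub> y) \<otimes>\<^bsub>C\<^esub> z = x \<otimes>\<^bsub>C\<^esub> (y \<otimes>\<^bsub>C\<^esub> z)"
proof (rule C_ext)
  fix k assume k: "k \<in> carrier G"
  define t where "t g h = (\<alpha> h (inv\<^bsub>G\<^esub> h \<otimes>\<^bsub>G\<^esub> k) \<otimes>\<^bsub>K\<^esub> \<alpha> g (inv\<^bsub>G\<^esub> g \<otimes>\<^bsub>G\<^esub> h)) \<odot>\<^bsub>A\<^esub>
    (x g \<otimes>\<^bsub>A\<^esub> \<phi> g (y (inv\<^bsub>G\<^esub> g \<otimes>\<^bsub>G\<^esub> h)) \<otimes>\<^bsub>A\<^esub> \<phi> h (z (inv\<^bsub>G\<^esub> h \<otimes>\<^bsub>G\<^esub> k)))" for g h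
  have t: "t g h \<in> carrier A" if "g \<in> carrier G" "h \<in> carrier G" for g h
    unfolding t_def using that k x y z
    by (intro A.smult_closed A.A.m_closed action_closed cocycle_closed C_app A.R.m_closed) auto
  have L: "((x \<otimes>\<^bsub>C\<^esub> y) \<otimes>\<^bsub>C\<^esub> z) k = (\<Oplus>\<^bsub>A\<^esub>h\<in>carrier G. \<Oplus>\<^bsub>A\<^esub>g\<in>carrier G. t g h)"
    unfolding mult_app[OF k]
  proof (rule A.M.finsum_cong'[OF refl])
    show "(\<lambda>h. \<Oplus>\<^bsub>A\<^esub>g\<in>carrier G. t g h) \<in> carrier G \<rightarrow> carrier A"
      by (intro Pi_I A.M.finsum_closed) (auto intro: t)
    fix h assume h: "h \<in> carrier G"
    let ?u = "\<lambda>g. \<alpha> g (inv\<^bsub>G\<^esub> g \<otimes>\<^bsub>G\<^esub> h) \<odot>\<^bsub>A\<^esub> (x g \<otimes>\<^bsub>A\<^esub> \<phi> g (y (inv\<^bsub>G\<^esub> g \<otimes>\<^bsub>G\<^esub> h)))"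
    let ?c = "\<alpha> h (inv\<^bsub>G\<^esub> h \<otimes>\<^bsub>G\<^esub> k)" and ?w = "\<phi> h (z (inv\<^bsub>G\<^esub> h \<otimes>\<^bsub>G\<^esub> k))"
    have u: "?u \<in> carrier G \<rightarrow> carrier A" using x y h by (auto intro: term_closed)
    have w: "?w \<in> carrier A" using h k z by (simp add: action_closed C_app)
    have c: "?c \<in> carrier K" using h k by (simp add: cocycle_closed)
    have "?c \<odot>\<^bsub>A\<^esub> ((x \<otimes>\<^bsub>C\<^esub> y) h \<otimes>\<^bsub>A\<^esub> ?w) = ?c \<odot>\<^bsub>A\<^esub> (\<Oplus>\<^bsub>A\<^esub>g\<in>carrier G. ?u g \<otimes>\<^bsub>A\<^esub> ?w)"
      unfolding mult_app[OF h] using A.A.finsum_ldistr[OF fin w u] by simp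
    also have "\<dots> = (\<Oplus>\<^bsub>A\<^esub>g\<in>carrier G. ?c \<odot>\<^bsub>A\<^esub> (?u g \<otimes>\<^bsub>A\<^esub> ?w))"
      using fin c u w by (intro A.finsum_smult_ldistr) (auto simp: Pi_iff)
    also have "\<dots> = (\<Oplus>\<^bsub>A\<^esub>g\<in>carrier G. t g h)"
    proof (rule A.M.finsum_cong'[OF refl])
      show "(\<lambda>g. t g h) \<in> carrier G \<rightarrow> carrier A" using h by (auto intro: t)
      fix g assume g: "g \<in> carrier G"
      show "?c \<odot>\<^bsub>A\<^esub> (?u g \<otimes>\<^bsub>A\<^esub> ?w) = t g h"
        using g h k w c x y unfolding t_def
        by (simp add: A.smult_mult_left A.smult_assoc1 C_app action_closed cocycle_closed)
    qed
    finally show "?c \<odot>\<^bsub>A\<^esub> ((x \<otimes>\<^bsub>C\<^esub> y) h \<otimes>\<^bsub>A\<^esub> ?w) = (\<Oplus>\<^bsub>A\<^esub>g\<in>carrier G. t g h)" .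
  qed
  have R: "(x \<otimes>\<^bsub>C\<^esub> (y \<otimes>\<^bsub>C\<^esub> z)) k = (\<Oplus>\<^bsub>A\<^esub>g\<in>carrier G. \<Oplus>\<^bsub>A\<^esub>h\<in>carrier G. t g h)"
    unfolding mult_app[OF k]
  proof (rule A.M.finsum_cong'[OF refl])
    show "(\<lambda>g. \<Oplus>\<^bsub>A\<^esub>h\<in>carrier G. t g h) \<in> carrier G \<rightarrow> carrier A"
      by (intro Pi_I A.M.finsum_closed) (auto intro: t)
    fix g assume g: "g \<in> carrier G"
    let ?k = "inv\<^bsub>G\<^esub> g \<otimes>\<^bsub>G\<^esub> k"
    have k': "?k \<in> carrier G" using g k by simp
    let ?u = "\<lambda>l. \<alpha> l (inv\<^bsub>G\<^esub> l \<otimes>\<^bsub>G\<^esub> ?k) \<odot>\<^bsub>A\<^esub> (y l \<otimes>\<^bsub>A\<^esub> \<phi> l (z (inv\<^bsub>G\<^esub> l \<otimes>\<^bsub>G\<^esub> ?k)))"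
    have u: "?u \<in> carrier G \<rightarrow> carrier A" using z y k' by (auto intro: term_closed)
    have u': "(\<lambda>l. \<phi> g (?u l)) \<in> carrier G \<rightarrow> carrier A" using u g by (auto simp: Pi_iff intro!: action_closed)
    have c: "\<alpha> g ?k \<in> carrier K" using g k' by (simp add: cocycle_closed)
    have xg: "x g \<in> carrier A" using x g by (rule C_app)
    have "\<alpha> g ?k \<odot>\<^bsub>A\<^esub> (x g \<otimes>\<^bsub>A\<^esub> \<phi> g ((y \<otimes>\<^bsub>C\<^esub> z) ?k)) =
        \<alpha> g ?k \<odot>\<^bsub>A\<^esub> (\<Oplus>\<^bsub>A\<^esub>l\<in>carrier G. x g \<otimes>\<^bsub>A\<^esub> \<phi> g (?u l))"
      unfolding mult_app[OF k'] action_finsum[OF g fin u]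
      using A.A.finsum_rdistr[OF fin xg u'] by simp
    also have "\<dots> = (\<Oplus>\<^bsub>A\<^esub>l\<in>carrier G. \<alpha> g ?k \<odot>\<^bsub>A\<^esub> (x g \<otimes>\<^bsub>A\<^esub> \<phi> g (?u l)))"
      using fin c u' xg by (intro A.finsum_smult_ldistr) (auto simp: Pi_iff)
    also have "\<dots> = (\<Oplus>\<^bsub>A\<^esub>l\<in>carrier G. t g (g \<otimes>\<^bsub>G\<^esub> l))"
    proof (rule A.M.finsum_cong'[OF refl])
      show "(\<lambda>l. t g (g \<otimes>\<^bsub>G\<^esub> l)) \<in> carrier G \<rightarrow> carrier A" using g by (auto intro: t)
      fix l assume l: "l \<in> carrier G"
      let ?m = "inv\<^bsub>G\<^esub> l \<otimes>\<^bsub>G\<^esub> ?k"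
      have m: "?m \<in> carrier G" using l k' by simp
      have e1: "inv\<^bsub>G\<^esub> (g \<otimes>\<^bsub>G\<^esub> l) \<otimes>\<^bsub>G\<^esub> k = ?m"
        using g l k by (simp add: G.inv_mult_group G.m_assoc)
      have e2: "inv\<^bsub>G\<^esub> g \<otimes>\<^bsub>G\<^esub> (g \<otimes>\<^bsub>G\<^esub> l) = l"
        using g l by (simp add: G.inv_solve_left')
      have e3: "l \<otimes>\<^bsub>G\<^esub> ?m = ?k"
        using l k' by (simp add: G.m_assoc[symmetric])
      have al: "\<alpha> g ?k \<otimes>\<^bsub>K\<^esub> \<alpha> l ?m = \<alpha> (g \<otimes>\<^bsub>G\<^esub> l) ?m \<otimes>\<^bsub>K\<^esub> \<alpha> g l"
        using cocycle_eq[OF g l m] g l m k' unfolding e3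
        by (simp add: cocycle_closed A.R.m_comm)
      have yl: "y l \<in> carrier A" and zm: "z ?m \<in> carrier A"
        using y l z m by (auto intro: C_app)
      have "\<alpha> g ?k \<odot>\<^bsub>A\<^esub> (x g \<otimes>\<^bsub>A\<^esub> \<phi> g (?u l)) =
         (\<alpha> g ?k \<otimes>\<^bsub>K\<^esub> \<alpha> l ?m) \<odot>\<^bsub>A\<^esub> (x g \<otimes>\<^bsub>A\<^esub> (\<phi> g (y l) \<otimes>\<^bsub>A\<^esub> \<phi> g (\<phi> l (z ?m))))"
        using g l m k' xg yl zm c
        by (simp add: action_smult action_mult action_closed cocycle_closed
              A.smult_mult_right A.smult_assoc1)
      also have "\<dots> = t g (g \<otimes>\<^bsub>G\<^esub> l)"
        unfolding t_def e1 e2 al using g l xg yl zm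
        by (simp add: action_comp A.A.m_assoc action_closed)
      finally show "\<alpha> g ?k \<odot>\<^bsub>A\<^esub> (x g \<otimes>\<^bsub>A\<^esub> \<phi> g (?u l)) = t g (g \<otimes>\<^bsub>G\<^esub> l)" .
    qed
    also have "\<dots> = (\<Oplus>\<^bsub>A\<^esub>h\<in>(\<lambda>l. g \<otimes>\<^bsub>G\<^esub> l) ` carrier G. t g h)"
      using g by (intro A.M.finsum_reindex[symmetric]) (auto intro: t G.inj_on_cmult)
    also have "(\<lambda>l. g \<otimes>\<^bsub>G\<^esub> l) ` carrier G = carrier G"
      using g by (rule G.surj_const_mult)
    finally show "\<alpha> g ?k \<odot>\<^bsub>A\<^esub> (x g \<otimes>\<^bsub>A\<^esub> \<phi> g ((y \<otimes>\<^bsub>C\<^esub> z) ?k)) = (\<Oplus>\<^bsub>A\<^esub>h\<in>carrier G. t g h)" .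
  qed
  show "((x \<otimes>\<^bsub>C\<^esub> y) \<otimes>\<^bsub>C\<^esub> z) k = (x \<otimes>\<^bsub>C\<^esub> (y \<otimes>\<^bsub>C\<^esub> z)) k"
    unfolding L R by (rule finsum_swap[OF fin fin t])
qed (auto intro!: mult_C x y z)

lemma cocycle_e_left: assumes k: "k \<in> carrier G" shows "\<alpha> \<one>\<^bsub>G\<^esub> k = \<alpha> \<one>\<^bsub>G\<^esub> \<one>\<^bsub>G\<^esub>"
proof -
  have "\<alpha> \<one>\<^bsub>G\<^esub> k \<otimes>\<^bsub>K\<^esub> \<alpha> \<one>\<^bsub>G\<^esub> k = \<alpha> \<one>\<^bsub>G\<^esub> k \<otimes>\<^bsub>K\<^esub> \<alpha> \<one>\<^bsub>G\<^esub> \<one>\<^bsub>G\<^esub>"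
    using cocycle_eq[of "\<one>\<^bsub>G\<^esub>" "\<one>\<^bsub>G\<^esub>" k] k by simp
  then show ?thesis using k by (simp add: A.R.Units_l_cancel cocycle_unit cocycle_closed)
qed

lemma cocycle_e_right: assumes k: "k \<in> carrier G" shows "\<alpha> k \<one>\<^bsub>G\<^esub> = \<alpha> \<one>\<^bsub>G\<^esub> \<one>\<^bsub>G\<^esub>"
proof -
  have "\<alpha> k \<one>\<^bsub>G\<^esub> \<otimes>\<^bsub>K\<^esub> \<alpha> \<one>\<^bsub>G\<^esub> \<one>\<^bsub>G\<^esub> = \<alpha> k \<one>\<^bsub>G\<^esub> \<otimes>\<^bsub>K\<^esub> \<alpha> k \<one>\<^bsub>G\<^esub>"
    using cocycle_eq[of k "\<one>\<^bsub>G\<^esub>" "\<one>\<^bsub>G\<^esub>"] k by (simp add: cocycle_closed A.R.m_comm)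
  then show ?thesis using k by (simp add: A.R.Units_l_cancel cocycle_unit cocycle_closed)
qed

lemma one_C: "\<one>\<^bsub>C\<^esub> \<in> carrier C"
proof -
  have "inv\<^bsub>K\<^esub> (\<alpha> \<one>\<^bsub>G\<^esub> \<one>\<^bsub>G\<^esub>) \<odot>\<^bsub>A\<^esub> \<one>\<^bsub>A\<^esub> \<in> carrier A"
    using cocycle_unit by simp
  then show ?thesis using monomial_C by (simp add: twisted_crossed_product_def)
qed

lemma one_app: "k \<in> carrier G \<Longrightarrow>
  \<one>\<^bsub>C\<^esub> k = (if k = \<one>\<^bsub>G\<^esub> then inv\<^bsub>K\<^esub> (\<alpha> \<one>\<^bsub>G\<^esub> \<one>\<^bsub>G\<^esub>) \<odot>\<^bsub>A\<^esub> \<one>\<^bsub>A\<^esub> else \<zero>\<^bsub>A\<^esub>)"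
  by (simp add: twisted_crossed_product_def monomial_def)

lemma cancel:
  assumes "a \<in> carrier A"
  shows "\<alpha> \<one>\<^bsub>G\<^esub> \<one>\<^bsub>G\<^esub> \<odot>\<^bsub>A\<^esub> (inv\<^bsub>K\<^esub> (\<alpha> \<one>\<^bsub>G\<^esub> \<one>\<^bsub>G\<^esub>) \<odot>\<^bsub>A\<^esub> a) = a"
proof -
  have u: "\<alpha> \<one>\<^bsub>G\<^esub> \<one>\<^bsub>G\<^esub> \<in> Units K" by (simp add: cocycle_unit)
  have "\<alpha> \<one>\<^bsub>G\<^esub> \<one>\<^bsub>G\<^esub> \<odot>\<^bsub>A\<^esub> (inv\<^bsub>K\<^esub> (\<alpha> \<one>\<^bsub>G\<^esub> \<one>\<^bsub>G\<^esub>) \<odot>\<^bsub>A\<^esub> a) =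
      (\<alpha> \<one>\<^bsub>G\<^esub> \<one>\<^bsub>G\<^esub> \<otimes>\<^bsub>K\<^esub> inv\<^bsub>K\<^esub> (\<alpha> \<one>\<^bsub>G\<^esub> \<one>\<^bsub>G\<^esub>)) \<odot>\<^bsub>A\<^esub> a"
    using u assms by (intro A.smult_assoc1[symmetric]) auto
  then show ?thesis using u assms by simp
qed

lemma l_one_C: assumes x: "x \<in> carrier C" shows "\<one>\<^bsub>C\<^esub> \<otimes>\<^bsub>C\<^esub> x = x"
proof (rule C_ext)
  fix k assume k: "k \<in> carrier G"
  have i: "inv\<^bsub>K\<^esub> (\<alpha> \<one>\<^bsub>G\<^esub> \<one>\<^bsub>G\<^esub>) \<in> carrier K" using cocycle_unit by simp
  have xk: "x k \<in> carrier A" using x k by (rule C_app)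
  have "(\<one>\<^bsub>C\<^esub> \<otimes>\<^bsub>C\<^esub> x) k = (\<Oplus>\<^bsub>A\<^esub>g\<in>carrier G. if \<one>\<^bsub>G\<^esub> = g then x k else \<zero>\<^bsub>A\<^esub>)"
    unfolding mult_app[OF k]
  proof (rule A.M.finsum_cong'[OF refl])
    show "(\<lambda>g. if \<one>\<^bsub>G\<^esub> = g then x k else \<zero>\<^bsub>A\<^esub>) \<in> carrier G \<rightarrow> carrier A" using xk by auto
    fix g assume g: "g \<in> carrier G"
    have "x (inv\<^bsub>G\<^esub> g \<otimes>\<^bsub>G\<^esub> k) \<in> carrier A" using x g k by (intro C_app) auto
    then show "\<alpha> g (inv\<^bsub>G\<^esub> g \<otimes>\<^bsub>G\<^esub> k) \<odot>\<^bsub>A\<^esub> (\<one>\<^bsub>C\<^esub> g \<otimes>\<^bsub>A\<^esub> \<phi> g (x (inv\<^bsub>G\<^esub> g \<otimes>\<^bsub>G\<^esub> k))) =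
        (if \<one>\<^bsub>G\<^esub> = g then x k else \<zero>\<^bsub>A\<^esub>)"
      using g k xk i cancel[OF xk]
      by (cases "g = \<one>\<^bsub>G\<^esub>")
         (simp_all add: one_app action_closed cocycle_closed A.smult_mult_left action_id cocycle_e_left[OF k])
  qed
  also have "\<dots> = x k"
    using A.M.finsum_singleton[OF G.one_closed fin, of "\<lambda>_. x k"] xk by simp
  finally show "(\<one>\<^bsub>C\<^esub> \<otimes>\<^bsub>C\<^esub> x) k = x k" .
qed (auto intro!: mult_C one_C x)

lemma r_one_C: assumes x: "x \<in> carrier C" shows "x \<otimes>\<^bsub>C\<^esub> \<one>\<^bsub>C\<^esub> = x"
proof (rule C_ext)
  fix k assume k: "k \<in> carrier G"
  have i: "inv\<^bsub>K\<^esub> (\<alpha> \<one>\<^bsub>G\<^esub> \<one>\<^bsub>G\<^esub>) \<in> carrier K" using cocycle_unit by simp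
  have xk: "x k \<in> carrier A" using x k by (rule C_app)
  have "(x \<otimes>\<^bsub>C\<^esub> \<one>\<^bsub>C\<^esub>) k = (\<Oplus>\<^bsub>A\<^esub>g\<in>carrier G. if k = g then x k else \<zero>\<^bsub>A\<^esub>)"
    unfolding mult_app[OF k]
  proof (rule A.M.finsum_cong'[OF refl])
    show "(\<lambda>g. if k = g then x k else \<zero>\<^bsub>A\<^esub>) \<in> carrier G \<rightarrow> carrier A" using xk by auto
    fix g assume g: "g \<in> carrier G"
    have xg: "x g \<in> carrier A" using x g by (rule C_app)
    have "inv\<^bsub>G\<^esub> g \<otimes>\<^bsub>G\<^esub> k = \<one>\<^bsub>G\<^esub> \<longleftrightarrow> k = g"
      using G.inv_solve_left'[of "\<one>\<^bsub>G\<^esub>" g k] g k by simp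
    then show "\<alpha> g (inv\<^bsub>G\<^esub> g \<otimes>\<^bsub>G\<^esub> k) \<odot>\<^bsub>A\<^esub> (x g \<otimes>\<^bsub>A\<^esub> \<phi> g (\<one>\<^bsub>C\<^esub> (inv\<^bsub>G\<^esub> g \<otimes>\<^bsub>G\<^esub> k))) =
        (if k = g then x k else \<zero>\<^bsub>A\<^esub>)"
      using g k xk xg i cancel[OF xg]
      by (simp add: one_app action_closed cocycle_closed A.smult_mult_right action_smult action_one
            action_zero cocycle_e_right[OF g] cocycle_e_right[OF k])
  qed
  also have "\<dots> = x k"
    using A.M.finsum_singleton[OF k fin, of "\<lambda>_. x k"] xk by simp
  finally show "(x \<otimes>\<^bsub>C\<^esub> \<one>\<^bsub>C\<^esub>) k = x k" .
qed (auto intro!: mult_C one_C x)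

lemma add_app: "k \<in> carrier G \<Longrightarrow> (x \<oplus>\<^bsub>C\<^esub> y) k = x k \<oplus>\<^bsub>A\<^esub> y k"
  and smult_app: "k \<in> carrier G \<Longrightarrow> (c \<odot>\<^bsub>C\<^esub> x) k = c \<odot>\<^bsub>A\<^esub> x k"
  and zero_app: "k \<in> carrier G \<Longrightarrow> \<zero>\<^bsub>C\<^esub> k = \<zero>\<^bsub>A\<^esub>"
  by (simp_all add: twisted_crossed_product_def)

lemma add_C: "\<lbrakk>x \<in> carrier C; y \<in> carrier C\<rbrakk> \<Longrightarrow> x \<oplus>\<^bsub>C\<^esub> y \<in> carrier C"
  and smult_C: "\<lbrakk>c \<in> carrier K; x \<in> carrier C\<rbrakk> \<Longrightarrow> c \<odot>\<^bsub>C\<^esub> x \<in> carrier C"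
  and zero_C: "\<zero>\<^bsub>C\<^esub> \<in> carrier C"
  by (auto simp: twisted_crossed_product_def)

lemma abelian_group_C: "abelian_group C"
proof (rule abelian_groupI)
  fix x assume x: "x \<in> carrier C"
  show "\<exists>y\<in>carrier C. y \<oplus>\<^bsub>C\<^esub> x = \<zero>\<^bsub>C\<^esub>"
  proof (rule bexI)
    let ?y = "\<lambda>k\<in>carrier G. \<ominus>\<^bsub>A\<^esub> x k"
    show y: "?y \<in> carrier C" using x by (auto simp: carrier_C)
    show "?y \<oplus>\<^bsub>C\<^esub> x = \<zero>\<^bsub>C\<^esub>"
      using x y by (intro C_ext add_C zero_C) (simp_all add: add_app zero_app C_app A.M.l_neg)
  qed
next
  fix x y z assume "x \<in> carrier C" "y \<in> carrier C" "z \<in> carrier C"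
  then show "(x \<oplus>\<^bsub>C\<^esub> y) \<oplus>\<^bsub>C\<^esub> z = x \<oplus>\<^bsub>C\<^esub> (y \<oplus>\<^bsub>C\<^esub> z)"
    by (intro C_ext add_C) (simp_all add: add_app C_app A.M.a_assoc)
next
  fix x y assume "x \<in> carrier C" "y \<in> carrier C"
  then show "x \<oplus>\<^bsub>C\<^esub> y = y \<oplus>\<^bsub>C\<^esub> x"
    by (intro C_ext add_C) (simp_all add: add_app C_app A.M.a_comm)
next
  fix x assume "x \<in> carrier C"
  then show "\<zero>\<^bsub>C\<^esub> \<oplus>\<^bsub>C\<^esub> x = x"
    by (intro C_ext add_C zero_C) (simp_all add: add_app zero_app C_app)
qed (rule add_C zero_C; assumption)+

lemma l_distr_C:
  assumes "x \<in> carrier C" "y \<in> carrier C" "z \<in> carrier C"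
  shows "(x \<oplus>\<^bsub>C\<^esub> y) \<otimes>\<^bsub>C\<^esub> z = x \<otimes>\<^bsub>C\<^esub> z \<oplus>\<^bsub>C\<^esub> y \<otimes>\<^bsub>C\<^esub> z"
proof (rule C_ext)
  fix k assume k: "k \<in> carrier G"
  let ?t = "\<lambda>x g. \<alpha> g (inv\<^bsub>G\<^esub> g \<otimes>\<^bsub>G\<^esub> k) \<odot>\<^bsub>A\<^esub> (x g \<otimes>\<^bsub>A\<^esub> \<phi> g (z (inv\<^bsub>G\<^esub> g \<otimes>\<^bsub>G\<^esub> k)))"
  have t: "?t x g \<in> carrier A" "?t y g \<in> carrier A" if "g \<in> carrier G" for g
    using that assms k by (auto intro: term_closed)
  have "((x \<oplus>\<^bsub>C\<^esub> y) \<otimes>\<^bsub>C\<^esub> z) k = (\<Oplus>\<^bsub>A\<^esub>g\<in>carrier G. ?t x g \<oplus>\<^bsub>A\<^esub> ?t y g)"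
    unfolding mult_app[OF k]
    by (intro A.M.finsum_cong')
       (use assms k t in \<open>auto simp: add_app C_app action_closed cocycle_closed A.A.l_distr A.smult_r_distr\<close>)
  also have "\<dots> = (\<Oplus>\<^bsub>A\<^esub>g\<in>carrier G. ?t x g) \<oplus>\<^bsub>A\<^esub> (\<Oplus>\<^bsub>A\<^esub>g\<in>carrier G. ?t y g)"
    using t by (intro A.M.finsum_addf) auto
  finally show "((x \<oplus>\<^bsub>C\<^esub> y) \<otimes>\<^bsub>C\<^esub> z) k = (x \<otimes>\<^bsub>C\<^esub> z \<oplus>\<^bsub>C\<^esub> y \<otimes>\<^bsub>C\<^esub> z) k"
    unfolding add_app[OF k] mult_app[OF k] .
qed (auto intro!: mult_C add_C assms)

lemma r_distr_C:
  assumes "x \<in> carrier C" "y \<in> carrier C" "z \<in> carrier C"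
  shows "z \<otimes>\<^bsub>C\<^esub> (x \<oplus>\<^bsub>C\<^esub> y) = z \<otimes>\<^bsub>C\<^esub> x \<oplus>\<^bsub>C\<^esub> z \<otimes>\<^bsub>C\<^esub> y"
proof (rule C_ext)
  fix k assume k: "k \<in> carrier G"
  let ?t = "\<lambda>x g. \<alpha> g (inv\<^bsub>G\<^esub> g \<otimes>\<^bsub>G\<^esub> k) \<odot>\<^bsub>A\<^esub> (z g \<otimes>\<^bsub>A\<^esub> \<phi> g (x (inv\<^bsub>G\<^esub> g \<otimes>\<^bsub>G\<^esub> k)))"
  have t: "?t x g \<in> carrier A" "?t y g \<in> carrier A" if "g \<in> carrier G" for g
    using that assms k by (auto intro: term_closed)
  have "(z \<otimes>\<^bsub>C\<^esub> (x \<oplus>\<^bsub>C\<^esub> y)) k = (\<Oplus>\<^bsub>A\<^esub>g\<in>carrier G. ?t x g \<oplus>\<^bsub>A\<^esub> ?t y g)"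
    unfolding mult_app[OF k]
    by (intro A.M.finsum_cong')
       (use assms k t in \<open>auto simp: add_app C_app action_closed action_add cocycle_closed A.A.r_distr A.smult_r_distr\<close>)
  also have "\<dots> = (\<Oplus>\<^bsub>A\<^esub>g\<in>carrier G. ?t x g) \<oplus>\<^bsub>A\<^esub> (\<Oplus>\<^bsub>A\<^esub>g\<in>carrier G. ?t y g)"
    using t by (intro A.M.finsum_addf) auto
  finally show "(z \<otimes>\<^bsub>C\<^esub> (x \<oplus>\<^bsub>C\<^esub> y)) k = (z \<otimes>\<^bsub>C\<^esub> x \<oplus>\<^bsub>C\<^esub> z \<otimes>\<^bsub>C\<^esub> y) k"
    unfolding add_app[OF k] mult_app[OF k] .
qed (auto intro!: mult_C add_C assms)

lemma smult_mult_left_C: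
  assumes c: "c \<in> carrier K" and xy: "x \<in> carrier C" "y \<in> carrier C"
  shows "(c \<odot>\<^bsub>C\<^esub> x) \<otimes>\<^bsub>C\<^esub> y = c \<odot>\<^bsub>C\<^esub> (x \<otimes>\<^bsub>C\<^esub> y)"
proof (rule C_ext)
  fix k assume k: "k \<in> carrier G"
  let ?t = "\<lambda>g. \<alpha> g (inv\<^bsub>G\<^esub> g \<otimes>\<^bsub>G\<^esub> k) \<odot>\<^bsub>A\<^esub> (x g \<otimes>\<^bsub>A\<^esub> \<phi> g (y (inv\<^bsub>G\<^esub> g \<otimes>\<^bsub>G\<^esub> k)))"
  have t: "?t g \<in> carrier A" if "g \<in> carrier G" for g
    using that assms k by (auto intro: term_closed)
  have "((c \<odot>\<^bsub>C\<^esub> x) \<otimes>\<^bsub>C\<^esub> y) k = (\<Oplus>\<^bsub>A\<^esub>g\<in>carrier G. c \<odot>\<^bsub>A\<^esub> ?t g)"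
    unfolding mult_app[OF k]
    by (intro A.M.finsum_cong')
       (use assms k t in \<open>auto simp: smult_app C_app action_closed cocycle_closed A.smult_mult_left
          A.smult_assoc1[symmetric] A.R.m_comm\<close>)
  also have "\<dots> = c \<odot>\<^bsub>A\<^esub> (\<Oplus>\<^bsub>A\<^esub>g\<in>carrier G. ?t g)"
    using t c fin by (intro A.finsum_smult_ldistr[symmetric]) auto
  finally show "((c \<odot>\<^bsub>C\<^esub> x) \<otimes>\<^bsub>C\<^esub> y) k = (c \<odot>\<^bsub>C\<^esub> (x \<otimes>\<^bsub>C\<^esub> y)) k"
    unfolding smult_app[OF k] mult_app[OF k] .
qed (auto intro!: mult_C smult_C assms)

lemma smult_mult_right_C:
  assumes c: "c \<in> carrier K" and xy: "x \<in> carrier C" "y \<in> carrier C"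
  shows "x \<otimes>\<^bsub>C\<^esub> (c \<odot>\<^bsub>C\<^esub> y) = c \<odot>\<^bsub>C\<^esub> (x \<otimes>\<^bsub>C\<^esub> y)"
proof (rule C_ext)
  fix k assume k: "k \<in> carrier G"
  let ?t = "\<lambda>g. \<alpha> g (inv\<^bsub>G\<^esub> g \<otimes>\<^bsub>G\<^esub> k) \<odot>\<^bsub>A\<^esub> (x g \<otimes>\<^bsub>A\<^esub> \<phi> g (y (inv\<^bsub>G\<^esub> g \<otimes>\<^bsub>G\<^esub> k)))"
  have t: "?t g \<in> carrier A" if "g \<in> carrier G" for g
    using that assms k by (auto intro: term_closed)
  have "(x \<otimes>\<^bsub>C\<^esub> (c \<odot>\<^bsub>C\<^esub> y)) k = (\<Oplus>\<^bsub>A\<^esub>g\<in>carrier G. c \<odot>\<^bsub>A\<^esub> ?t g)"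
    unfolding mult_app[OF k]
    by (intro A.M.finsum_cong')
       (use assms k t in \<open>auto simp: smult_app C_app action_closed action_smult cocycle_closed A.smult_mult_right
          A.smult_assoc1[symmetric] A.R.m_comm\<close>)
  also have "\<dots> = c \<odot>\<^bsub>A\<^esub> (\<Oplus>\<^bsub>A\<^esub>g\<in>carrier G. ?t g)"
    using t c fin by (intro A.finsum_smult_ldistr[symmetric]) auto
  finally show "(x \<otimes>\<^bsub>C\<^esub> (c \<odot>\<^bsub>C\<^esub> y)) k = (c \<odot>\<^bsub>C\<^esub> (x \<otimes>\<^bsub>C\<^esub> y)) k"
    unfolding smult_app[OF k] mult_app[OF k] .
qed (auto intro!: mult_C smult_C assms)

lemma module_C: "module K C"
proof (rule moduleI)
  fix c d x assume "c \<in> carrier K" "d \<in> carrier K" "x \<in> carrier C"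
  then show "(c \<oplus>\<^bsub>K\<^esub> d) \<odot>\<^bsub>C\<^esub> x = c \<odot>\<^bsub>C\<^esub> x \<oplus>\<^bsub>C\<^esub> d \<odot>\<^bsub>C\<^esub> x"
    and "(c \<otimes>\<^bsub>K\<^esub> d) \<odot>\<^bsub>C\<^esub> x = c \<odot>\<^bsub>C\<^esub> (d \<odot>\<^bsub>C\<^esub> x)"
    by (intro C_ext add_C smult_C;
        simp add: add_app smult_app C_app A.smult_l_distr A.smult_assoc1)+
next
  fix c x y assume "c \<in> carrier K" "x \<in> carrier C" "y \<in> carrier C"
  then show "c \<odot>\<^bsub>C\<^esub> (x \<oplus>\<^bsub>C\<^esub> y) = c \<odot>\<^bsub>C\<^esub> x \<oplus>\<^bsub>C\<^esub> c \<odot>\<^bsub>C\<^esub> y"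
    by (intro C_ext add_C smult_C; simp add: add_app smult_app C_app A.smult_r_distr)
next
  fix x assume "x \<in> carrier C"
  then show "\<one>\<^bsub>K\<^esub> \<odot>\<^bsub>C\<^esub> x = x"
    by (intro C_ext smult_C; simp add: smult_app C_app)
qed (auto intro: smult_C abelian_group_C A.R.is_cring)

lemma ring_C: "ring C"
proof (rule ringI)
  show "abelian_group C" by (rule abelian_group_C)
  show "monoid C" by (rule monoidI) (auto intro: mult_C one_C mult_assoc_C l_one_C r_one_C)
qed (auto intro: l_distr_C r_distr_C)

theorem assoc_algebra_C: "assoc_algebra K C"
proof -
  have "vectorspace K C"
    using module_C A.field_axioms by (simp add: vectorspace_def)
  then show ?thesis
    using ring_C by (intro assoc_algebra.intro assoc_algebra_axioms.intro smult_mult_left_C smult_mult_right_C)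
qed

end
end

theory Submission
  imports Defs
begin

text \<open>
  Put \<open>\<langle>\<langle>x, y\<rangle>\<rangle> = \<langle>(xy)(e), 1\<rangle>\<close>, where \<open>(xy)(e)\<close> is the coefficient of \<open>xy\<close> at the
  identity; associativity of this form is associativity of the crossed product, and pairing with
  monomials gives non-degeneracy. Writing \<open>j\<close> for the Jacobian of \<open>g\<close>, the formula for the
  Nakayama automorphism comes down to
  \<open>\<langle>b, g\<inverse>(\<sigma> a) \<sigma> j\<rangle> = \<langle>j b, g\<inverse>(\<sigma> a)\<rangle> = \<langle>g b, \<sigma> a\<rangle> = \<langle>a, g b\<rangle>\<close>.
  Any map \<open>s\<close> with \<open>\<langle>x, y\<rangle> = \<langle>y, s x\<rangle>\<close> is an injective algebra homomorphism by
  non-degeneracy; surjectivity holds here because the Jacobians are invertible.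
\<close>

section \<open>Linear functionals and non-degenerate forms on vector spaces\<close>

definition linear_functional ::
  "('k, 'm) ring_scheme \<Rightarrow> ('k, 'a, 'n) module_scheme \<Rightarrow> ('a \<Rightarrow> 'k) \<Rightarrow> bool"
  where "linear_functional K V f \<longleftrightarrow>
    f \<in> carrier V \<rightarrow> carrier K \<and>
    (\<forall>x\<in>carrier V. \<forall>y\<in>carrier V. f (x \<oplus>\<^bsub>V\<^esub> y) = f x \<oplus>\<^bsub>K\<^esub> f y) \<and>
    (\<forall>c\<in>carrier K. \<forall>x\<in>carrier V. f (c \<odot>\<^bsub>V\<^esub> x) = c \<otimes>\<^bsub>K\<^esub> f x)"

lemma bilinear_formD:
  assumes "bilinear_form K V B"
  shows bilinear_form_closed: "\<lbrakk>x \<in> carrier V; y \<in> carrier V\<rbrakk> \<Longrightarrow> B x y \<in> carrier K"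
    and bilinear_form_add_left: "\<lbrakk>x \<in> carrier V; y \<in> carrier V; z \<in> carrier V\<rbrakk> \<Longrightarrow>
      B (x \<oplus>\<^bsub>V\<^esub> y) z = B x z \<oplus>\<^bsub>K\<^esub> B y z"
    and bilinear_form_add_right: "\<lbrakk>x \<in> carrier V; y \<in> carrier V; z \<in> carrier V\<rbrakk> \<Longrightarrow>
      B x (y \<oplus>\<^bsub>V\<^esub> z) = B x y \<oplus>\<^bsub>K\<^esub> B x z"
    and bilinear_form_smult_left: "\<lbrakk>c \<in> carrier K; x \<in> carrier V; y \<in> carrier V\<rbrakk> \<Longrightarrow>
      B (c \<odot>\<^bsub>V\<^esub> x) y = c \<otimes>\<^bsub>K\<^esub> B x y"
    and bilinear_form_smult_right: "\<lbrakk>c \<in> carrier K; x \<in> carrier V; y \<in> carrier V\<rbrakk> \<Longrightarrow>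
      B x (c \<odot>\<^bsub>V\<^esub> y) = c \<otimes>\<^bsub>K\<^esub> B x y"
  using assms by (simp_all add: bilinear_form_def)

lemma linear_functional_form_right:
  "\<lbrakk>bilinear_form K V B; x \<in> carrier V\<rbrakk> \<Longrightarrow> linear_functional K V (B x)"
  and linear_functional_form_left:
  "\<lbrakk>bilinear_form K V B; x \<in> carrier V\<rbrakk> \<Longrightarrow> linear_functional K V (\<lambda>y. B y x)"
  by (auto simp: linear_functional_def bilinear_formD)

context vectorspace
begin

lemma linear_functional_zero:
  assumes "linear_functional K V f"
  shows "f \<zero>\<^bsub>V\<^esub> = \<zero>\<^bsub>K\<^esub>"
proof -
  have "f (\<zero>\<^bsub>K\<^esub> \<odot>\<^bsub>V\<^esub> \<zero>\<^bsub>V\<^esub>) = \<zero>\<^bsub>K\<^esub> \<otimes>\<^bsub>K\<^esub> f \<zero>\<^bsub>V\<^esub>" "f \<zero>\<^bsub>V\<^esub> \<in> carrier K"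
    using assms R.zero_closed M.zero_closed unfolding linear_functional_def by blast+
  then show ?thesis by simp
qed

lemma linear_functional_finsum:
  assumes f: "linear_functional K V f" and "finite S" "v \<in> S \<rightarrow> carrier V"
  shows "f (\<Oplus>\<^bsub>V\<^esub>s\<in>S. v s) = (\<Oplus>\<^bsub>K\<^esub>s\<in>S. f (v s))"
  using assms(2,3)
proof (induction S rule: finite_induct)
  case empty
  then show ?case using linear_functional_zero[OF f] by simp
next
  case (insert a S)
  then have "f (v a) \<in> carrier K" "(\<lambda>s. f (v s)) \<in> S \<rightarrow> carrier K"
    "f (v a \<oplus>\<^bsub>V\<^esub> (\<Oplus>\<^bsub>V\<^esub>s\<in>S. v s)) = f (v a) \<oplus>\<^bsub>K\<^esub> f (\<Oplus>\<^bsub>V\<^esub>s\<in>S. v s)"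
    using f by (auto simp: linear_functional_def Pi_iff)
  then show ?case using insert by (simp add: Pi_iff)
qed

text \<open>Lets an identity between pairings be checked on a basis, where it can be read off from
  an equality of coefficients.\<close>

lemma linear_functional_eqI:
  assumes f: "linear_functional K V f" and h: "linear_functional K V h"
    and \<beta>: "finite \<beta>" "\<beta> \<subseteq> carrier V" "gen_set \<beta>"
    and eq: "\<And>b. b \<in> \<beta> \<Longrightarrow> f b = h b" and v: "v \<in> carrier V"
  shows "f v = h v"
proof -
  obtain a where a: "a \<in> \<beta> \<rightarrow> carrier K" "v = lincomb a \<beta>"
    using finite_in_span[OF \<beta>(1,2), of v] \<beta>(3) v by auto
  have *: "(\<lambda>b. a b \<odot>\<^bsub>V\<^esub> b) \<in> \<beta> \<rightarrow> carrier V" using a \<beta> by auto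
  have "f v = (\<Oplus>\<^bsub>K\<^esub>b\<in>\<beta>. f (a b \<odot>\<^bsub>V\<^esub> b))"
    unfolding a(2) lincomb_def by (rule linear_functional_finsum[OF f \<beta>(1) *])
  also have "\<dots> = (\<Oplus>\<^bsub>K\<^esub>b\<in>\<beta>. h (a b \<odot>\<^bsub>V\<^esub> b))"
    using f h \<beta>(2) a(1) eq
    by (intro R.finsum_cong') (auto simp: linear_functional_def Pi_iff subset_iff)
  also have "\<dots> = h v"
    unfolding a(2) lincomb_def by (rule linear_functional_finsum[OF h \<beta>(1) *, symmetric])
  finally show ?thesis .
qed

text \<open>Injectivity sends a basis to an independent set of the same cardinality, which is again
  a basis by dimension. Every vector is then a combination of images of basis vectors, hence the
  image of a combination.\<close>

lemma inj_endomorphism_surj: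
  assumes lin: "linear_map K V V T" and fd: fin_dim and inj: "inj_on T (carrier V)"
  shows "T ` carrier V = carrier V"
proof -
  interpret T: linear_map K V V T by (rule lin)
  obtain \<beta> where \<beta>: "finite \<beta>" "basis \<beta>" using finite_basis_exists[OF fd] by blast
  then have li: "lin_indpt \<beta>" and \<beta>V: "\<beta> \<subseteq> carrier V" by (auto simp: basis_def)
  have T\<beta>: "T ` \<beta> \<subseteq> carrier V" using \<beta>V by auto
  have "lin_indpt (T ` \<beta>)"
  proof (rule finite_lin_indpt2)
    fix a assume a: "a \<in> T ` \<beta> \<rightarrow> carrier K" "lincomb a (T ` \<beta>) = \<zero>\<^bsub>V\<^esub>"
    \<comment> \<open>Pulling the coefficients back along \<open>T\<close> turns a combination of
      the images into the image of a combination over \<beta>; this is legitimate because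
      injectivity keeps the images distinct.\<close>
    have aT: "a \<circ> T \<in> \<beta> \<rightarrow> carrier K" using a(1) by auto
    have "T (lincomb (a \<circ> T) \<beta>) = \<zero>\<^bsub>V\<^esub>"
      using T.lincomb_linear_image[OF inj \<beta>V a(1) \<beta>(1)] a(2) by metis
    then have "lincomb (a \<circ> T) \<beta> = \<zero>\<^bsub>V\<^esub>"
      using inj_onD[OF inj _ lincomb_closed[OF \<beta>V aT] M.zero_closed] T.f0_is_0 by metis
    then show "\<forall>v\<in>T ` \<beta>. a v = \<zero>\<^bsub>K\<^esub>"
      using not_lindepD[OF li \<beta>(1) order_refl aT] by auto
  qed (use \<beta> T\<beta> in auto)
  moreover have "card (T ` \<beta>) = dim"
    using dim_basis[OF \<beta>] card_image[OF inj_on_subset[OF inj \<beta>V]] by simp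
  ultimately have "basis (T ` \<beta>)"
    using \<beta>(1) by (intro dim_li_is_basis[OF fd _ T\<beta>]) auto
  then have gen: "gen_set (T ` \<beta>)" by (simp add: basis_def)
  have "v \<in> T ` carrier V" if v: "v \<in> carrier V" for v
  proof -
    obtain a where a: "a \<in> T ` \<beta> \<rightarrow> carrier K" "lincomb a (T ` \<beta>) = v"
      using finite_in_span[OF finite_imageI[OF \<beta>(1)] T\<beta>, of v] gen v by auto
    then have "v = T (lincomb (a \<circ> T) \<beta>)"
      using T.lincomb_linear_image[OF inj \<beta>V a(1) \<beta>(1)] by simp
    moreover have "lincomb (a \<circ> T) \<beta> \<in> carrier V" using a(1) \<beta>V by (intro lincomb_closed) auto
    ultimately show ?thesis by blast
  qed
  then show ?thesis by auto
qed

lemma nondegenerate_left_cancel: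
  assumes B: "bilinear_form K V B" "nondegenerate_form K V B"
    and xy: "x \<in> carrier V" "y \<in> carrier V" "\<And>z. z \<in> carrier V \<Longrightarrow> B x z = B y z"
  shows "x = y"
proof -
  \<comment> \<open>The difference is written with the scalar minus one, so that additivity and
    homogeneity of \<open>B\<close> apply directly.\<close>
  have "B (x \<oplus>\<^bsub>V\<^esub> \<ominus>\<^bsub>K\<^esub> \<one>\<^bsub>K\<^esub> \<odot>\<^bsub>V\<^esub> y) z = \<zero>\<^bsub>K\<^esub>" if "z \<in> carrier V" for z
    using that xy bilinear_formD[OF B(1)] by (simp add: R.l_minus R.r_neg)
  then have "x \<oplus>\<^bsub>V\<^esub> \<ominus>\<^bsub>K\<^esub> \<one>\<^bsub>K\<^esub> \<odot>\<^bsub>V\<^esub> y = \<zero>\<^bsub>V\<^esub>"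
    using B(2) xy by (simp add: nondegenerate_form_def)
  then show ?thesis using xy M.minus_equality[of x "\<ominus>\<^bsub>V\<^esub> y"] by (simp add: smult_l_minus)
qed

lemma nondegenerate_right_cancel:
  assumes B: "bilinear_form K V B" "nondegenerate_form K V B"
    and xy: "x \<in> carrier V" "y \<in> carrier V" "\<And>z. z \<in> carrier V \<Longrightarrow> B z x = B z y"
  shows "x = y"
  using nondegenerate_left_cancel[of "\<lambda>x y. B y x" x y] assms
  by (auto simp: bilinear_form_def nondegenerate_form_def)

text \<open>
  For a basis \<open>\<beta>\<close>, the endomorphism sending \<open>x\<close> to the sum of the \<open>B x b \<odot> b\<close> over
  \<open>b \<in> \<beta>\<close> is injective by non-degeneracy, hence hits the sum of the \<open>f b \<odot> b\<close>.
\<close>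

lemma nondegenerate_form_represents:
  assumes fd: fin_dim and B: "bilinear_form K V B" "nondegenerate_form K V B"
    and f: "linear_functional K V f"
  obtains j where "j \<in> carrier V" "\<And>v. v \<in> carrier V \<Longrightarrow> f v = B j v"
proof -
  obtain \<beta> where \<beta>: "finite \<beta>" "basis \<beta>" using finite_basis_exists[OF fd] by blast
  then have gen: "gen_set \<beta>" and \<beta>V: "\<beta> \<subseteq> carrier V" by (auto simp: basis_def)
  \<comment> \<open>The basis criterion gives uniqueness among extensional coefficient functions
    only, hence the passage through restrictions to \<beta>.\<close>
  have unique: "a b = a' b"
    if "a \<in> \<beta> \<rightarrow> carrier K" "a' \<in> \<beta> \<rightarrow> carrier K" "lincomb a \<beta> = lincomb a' \<beta>" "b \<in> \<beta>" for a a' b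
  proof -
    have r: "lincomb (restrict c \<beta>) \<beta> = lincomb c \<beta>" "restrict c \<beta> \<in> \<beta> \<rightarrow>\<^sub>E carrier K"
      if "c \<in> \<beta> \<rightarrow> carrier K" for c
      using that \<beta>V by (auto simp: lincomb_def intro!: M.finsum_cong')
    have "lincomb a \<beta> \<in> carrier V" using that \<beta>V by auto
    then have "\<exists>!c. c \<in> \<beta> \<rightarrow>\<^sub>E carrier K \<and> lincomb c \<beta> = lincomb a \<beta>"
      using basis_criterion[OF \<beta>(1) \<beta>V] \<beta>(2) by blast
    then have "restrict a \<beta> = restrict a' \<beta>"
      using r[OF that(1)] r[OF that(2)] that(3) by metis
    then show ?thesis using that(4) by (metis restrict_apply')
  qed
  define T where "T x = lincomb (B x) \<beta>" for x
  have Bx: "B x \<in> \<beta> \<rightarrow> carrier K" if "x \<in> carrier V" for x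
    using that \<beta>V bilinear_form_closed[OF B(1)] by auto
  have "T \<in> module_hom K V V"
    unfolding module_hom_def T_def
  proof (intro CollectI conjI allI impI; (elim conjE)?)
    show "(\<lambda>x. lincomb (B x) \<beta>) \<in> carrier V \<rightarrow> carrier V" using Bx \<beta>V by auto
  next
    fix x y assume xy: "x \<in> carrier V" "y \<in> carrier V"
    have "lincomb (B (x \<oplus>\<^bsub>V\<^esub> y)) \<beta> = lincomb (\<lambda>v. B x v \<oplus>\<^bsub>K\<^esub> B y v) \<beta>"
      unfolding lincomb_def using xy \<beta>V bilinear_formD[OF B(1)]
      by (intro M.finsum_cong') (auto simp: subset_iff)
    then show "lincomb (B (x \<oplus>\<^bsub>V\<^esub> y)) \<beta> = lincomb (B x) \<beta> \<oplus>\<^bsub>V\<^esub> lincomb (B y) \<beta>"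
      using lincomb_sum[OF \<beta>(1) \<beta>V Bx Bx] xy by simp
  next
    fix c x assume cx: "c \<in> carrier K" "x \<in> carrier V"
    have "lincomb (B (c \<odot>\<^bsub>V\<^esub> x)) \<beta> = lincomb (\<lambda>v. c \<otimes>\<^bsub>K\<^esub> B x v) \<beta>"
      unfolding lincomb_def using cx \<beta>V bilinear_formD[OF B(1)]
      by (intro M.finsum_cong') (auto simp: subset_iff)
    then show "lincomb (B (c \<odot>\<^bsub>V\<^esub> x)) \<beta> = c \<odot>\<^bsub>V\<^esub> lincomb (B x) \<beta>"
      using lincomb_smult[OF \<beta>V Bx cx(1)] cx by simp
  qed
  then have lin: "linear_map K V V T"
    by (intro linear_map.intro mod_hom.intro mod_hom_axioms.intro vectorspace_axioms module_axioms)
  have inj: "inj_on T (carrier V)"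
  proof (rule inj_onI)
    fix x y assume xy: "x \<in> carrier V" "y \<in> carrier V" "T x = T y"
    have "B x v = B y v" if "v \<in> carrier V" for v
    proof (rule linear_functional_eqI[OF _ _ \<beta>(1) \<beta>V gen _ that])
      \<comment> \<open>Equal values of \<open>T\<close> are equal combinations over \<beta>, so
        their coefficients \<open>B x b\<close> and \<open>B y b\<close> coincide.\<close>
      show "B x b = B y b" if "b \<in> \<beta>" for b
        using unique[OF Bx[OF xy(1)] Bx[OF xy(2)] _ that] xy(3) unfolding T_def by blast
    qed (simp_all add: linear_functional_form_right B(1) xy)
    then show "x = y" using nondegenerate_left_cancel[OF B] xy by blast
  qed
  have f\<beta>: "f \<in> \<beta> \<rightarrow> carrier K" using f \<beta>V by (auto simp: linear_functional_def)
  then have "lincomb f \<beta> \<in> T ` carrier V"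
    unfolding inj_endomorphism_surj[OF lin fd inj] using \<beta>V by auto
  then obtain j where j: "j \<in> carrier V" "lincomb f \<beta> = lincomb (B j) \<beta>"
    by (auto simp: T_def)
  show thesis
  proof (rule that[OF j(1)])
    fix v assume v: "v \<in> carrier V"
    \<comment> \<open>Comparing coefficients in \<open>j(2)\<close> shows that \<open>f\<close> and
      \<open>B j\<close> agree on \<beta>; linearity extends this to all vectors.\<close>
    show "f v = B j v"
      by (rule linear_functional_eqI[OF f linear_functional_form_right[OF B(1) j(1)] \<beta>(1) \<beta>V gen _ v])
         (rule unique[OF f\<beta> Bx[OF j(1)] j(2)])
  qed
qed

end

section \<open>Algebra automorphisms and a criterion for Nakayama automorphisms\<close>

lemma algebra_automorphismD:
  assumes "algebra_automorphism K A u"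
  shows algebra_automorphism_closed: "x \<in> carrier A \<Longrightarrow> u x \<in> carrier A"
    and algebra_automorphism_add: "\<lbrakk>x \<in> carrier A; y \<in> carrier A\<rbrakk> \<Longrightarrow> u (x \<oplus>\<^bsub>A\<^esub> y) = u x \<oplus>\<^bsub>A\<^esub> u y"
    and algebra_automorphism_mult: "\<lbrakk>x \<in> carrier A; y \<in> carrier A\<rbrakk> \<Longrightarrow> u (x \<otimes>\<^bsub>A\<^esub> y) = u x \<otimes>\<^bsub>A\<^esub> u y"
    and algebra_automorphism_one: "u \<one>\<^bsub>A\<^esub> = \<one>\<^bsub>A\<^esub>"
    and algebra_automorphism_smult: "\<lbrakk>c \<in> carrier K; x \<in> carrier A\<rbrakk> \<Longrightarrow> u (c \<odot>\<^bsub>A\<^esub> x) = c \<odot>\<^bsub>A\<^esub> u x"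
    and algebra_automorphism_image: "u ` carrier A = carrier A"
  using assms by (auto simp: algebra_automorphism_def bij_betw_def dest: ring_iso_memE)

lemma associative_formD:
  "\<lbrakk>associative_form A B; x \<in> carrier A; y \<in> carrier A; z \<in> carrier A\<rbrakk> \<Longrightarrow>
    B (x \<otimes>\<^bsub>A\<^esub> y) z = B x (y \<otimes>\<^bsub>A\<^esub> z)"
  by (simp add: associative_form_def)

text \<open>Since \<open>B z (s w) = B w z\<close>, each law for \<open>s\<close> is tested by
  pairing with \<open>z\<close> on the left: it becomes a law of \<open>B\<close>, and right
  cancellation concludes. Surjectivity enters as a hypothesis, which the crossed product supplies
  through explicit preimages.\<close>

lemma (in assoc_algebra) nakayama_automorphismI:
  assumes B: "bilinear_form K A B" "nondegenerate_form K A B" and assoc: "associative_form A B"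
    and surj: "s ` carrier A = carrier A"
    and nak: "\<And>x y. \<lbrakk>x \<in> carrier A; y \<in> carrier A\<rbrakk> \<Longrightarrow> B x y = B y (s x)"
  shows "nakayama_automorphism K A B s"
proof -
  note form = bilinear_formD[OF B(1)] and assocD = associative_formD[OF assoc]
  note rcancel = nondegenerate_right_cancel[OF B]
  have s: "s x \<in> carrier A" if "x \<in> carrier A" for x using surj that by blast
  have "s (x \<otimes> y) = s x \<otimes> s y" if xy: "x \<in> carrier A" "y \<in> carrier A" for x y
  proof (rule rcancel)
    fix z assume z: "z \<in> carrier A"
    \<comment> \<open>The factors rotate: \<open>x\<close> and then \<open>y\<close> move from the
      first slot to the end of the second, each picking up an \<open>s\<close>, until only
      \<open>z\<close> is left in front.\<close>
    have "B z (s (x \<otimes> y)) = B x (y \<otimes> z)" using xy z nak[of "x \<otimes> y" z] assocD by simp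
    also have "\<dots> = B y (z \<otimes> s x)" using xy z s nak[of x "y \<otimes> z"] assocD by simp
    also have "\<dots> = B z (s x \<otimes> s y)" using xy z s nak[of y "z \<otimes> s x"] assocD by simp
    finally show "B z (s (x \<otimes> y)) = B z (s x \<otimes> s y)" .
  qed (use xy s in auto)
  moreover have "s (x \<oplus> y) = s x \<oplus> s y" if xy: "x \<in> carrier A" "y \<in> carrier A" for x y
    by (rule rcancel) (use xy s form in \<open>simp_all add: nak[symmetric]\<close>)
  moreover have "s (c \<odot> x) = c \<odot> s x" if cx: "c \<in> carrier K" "x \<in> carrier A" for c x
    by (rule rcancel) (use cx s form in \<open>simp_all add: nak[symmetric]\<close>)
  moreover have "s \<one> = \<one>"
  proof (rule rcancel)
    fix z assume z: "z \<in> carrier A"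
    \<comment> \<open>Associativity at \<open>\<one>\<close>, \<open>z\<close>,
      \<open>\<one>\<close> gives \<open>B z \<one> = B \<one> z\<close>.\<close>
    then show "B z (s \<one>) = B z \<one>" using nak[of \<one> z] assocD[of \<one> z \<one>] by simp
  qed (use s in auto)
  moreover have "inj_on s (carrier A)"
  proof (rule inj_onI)
    fix x y assume "x \<in> carrier A" "y \<in> carrier A" "s x = s y"
    then show "x = y" using nak by (intro nondegenerate_left_cancel[OF B]) auto
  qed
  ultimately show ?thesis
    using s surj nak
    by (auto simp: nakayama_automorphism_def algebra_automorphism_def ring_iso_def bij_betw_def
        intro!: ring_hom_memI)
qed

text \<open>Both values pair with every \<open>z\<close> to \<open>B x z\<close>. The equality is
  pointwise on the carrier, where alone the two maps are constrained.\<close>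

lemma (in assoc_algebra) nakayama_automorphism_unique:
  assumes "bilinear_form K A B" "nondegenerate_form K A B"
    and "nakayama_automorphism K A B s" "nakayama_automorphism K A B s'" "x \<in> carrier A"
  shows "s x = s' x"
  using assms(3-)
  by (intro nondegenerate_right_cancel[OF assms(1,2)])
     (auto simp: nakayama_automorphism_def algebra_automorphism_closed)

section \<open>The Nakayama Jacobian of an algebra automorphism\<close>

locale frobenius_form = assoc_algebra K A for K and A (structure) +
  fixes B
  assumes frobenius: "frobenius_algebra K A B"
begin

lemma fin_dim_A: "fin_dim"
  and form: "bilinear_form K A B"
  and nondeg: "nondegenerate_form K A B"
  and assoc: "associative_form A B"
  using frobenius by (auto simp: frobenius_algebra_def)

text \<open>Justifies the definite description. Let \<open>j\<close> represent the functional
  sending \<open>y\<close> to \<open>B \<one> (u y)\<close>; then \<open>B (u x) (u y) = B \<one> (u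
  (x \<otimes> y)) = B j (x \<otimes> y) = B (j \<otimes> x) y\<close>. Taking
  \<open>x = \<one>\<close> forces uniqueness.\<close>

lemma nakayama_jacobian_ex1:
  assumes u: "algebra_automorphism K A u"
  shows "\<exists>!j. j \<in> carrier A \<and>
    (\<forall>x\<in>carrier A. \<forall>y\<in>carrier A. B (u x) (u y) = B (j \<otimes> x) y)"
proof -
  note uD = algebra_automorphismD[OF u] and assocD = associative_formD[OF assoc]
  have "linear_functional K A (\<lambda>y. B \<one> (u y))"
    by (auto simp: linear_functional_def uD bilinear_formD[OF form])
  then obtain j where j: "j \<in> carrier A" "\<And>y. y \<in> carrier A \<Longrightarrow> B \<one> (u y) = B j y"
    using nondegenerate_form_represents[OF fin_dim_A form nondeg] by blast
  have *: "B (u x) (u y) = B (j \<otimes> x) y" if "x \<in> carrier A" "y \<in> carrier A" for x y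
    using that j assocD[of \<one> "u x" "u y"] assocD[of j x y] j(2)[of "x \<otimes> y"] by (simp add: uD)
  show ?thesis
  proof (rule ex1I[of _ j])
    fix i assume i: "i \<in> carrier A \<and> (\<forall>x\<in>carrier A. \<forall>y\<in>carrier A. B (u x) (u y) = B (i \<otimes> x) y)"
    have "B i y = B j y" if "y \<in> carrier A" for y
      using i j(1) *[of \<one> y] that by (metis A.one_closed A.r_one)
    then show "i = j" using i j(1) by (intro nondegenerate_left_cancel[OF form nondeg]) auto
  qed (use j * in auto)
qed

lemma
  assumes u: "algebra_automorphism K A u"
  shows nakayama_jacobian_closed: "nakayama_jacobian A B u \<in> carrier A"
    and nakayama_jacobian: "\<lbrakk>x \<in> carrier A; y \<in> carrier A\<rbrakk> \<Longrightarrow>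
      B (u x) (u y) = B (nakayama_jacobian A B u \<otimes> x) y"
  using theI'[OF nakayama_jacobian_ex1[OF u]] unfolding nakayama_jacobian_def by blast+

text \<open>A case of the chain rule: the composite of \<open>u\<close> and \<open>v\<close> is the
  identity, whose Jacobian is \<open>\<one>\<close>. It is proved by undoing first \<open>v\<close>
  and then \<open>u\<close> under the form.\<close>

lemma nakayama_jacobian_left_inverse:
  assumes u: "algebra_automorphism K A u" and v: "algebra_automorphism K A v"
    and uv: "\<And>x. x \<in> carrier A \<Longrightarrow> u (v x) = x"
    and vu: "\<And>x. x \<in> carrier A \<Longrightarrow> v (u x) = x"
  shows "v (nakayama_jacobian A B v) \<otimes> nakayama_jacobian A B u = \<one>"
proof -
  let ?j = "nakayama_jacobian A B"
  note uD = algebra_automorphismD[OF u] and vD = algebra_automorphismD[OF v]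
  have j: "?j u \<in> carrier A" "?j v \<in> carrier A" using u v by (auto intro: nakayama_jacobian_closed)
  have "?j v \<otimes> u (?j u) = \<one>"
  proof (rule nondegenerate_left_cancel[OF form nondeg])
    fix z assume z: "z \<in> carrier A"
    have "B (?j v \<otimes> u (?j u)) z = B (v (u (?j u))) (v z)"
      using nakayama_jacobian[OF v, of "u (?j u)" z] z j uD by simp
    also have "v (u (?j u)) = ?j u" using j vu by simp
    also have "B (?j u) (v z) = B \<one> z"
      using nakayama_jacobian[OF u, of \<one> "v z"] z j uD vD uv by simp
    finally show "B (?j v \<otimes> u (?j u)) z = B \<one> z" .
  qed (use j uD in auto)
  \<comment> \<open>Applying \<open>v\<close> removes the \<open>u\<close> in front of the second
    factor and leaves the Jacobian of \<open>u\<close> bare.\<close>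
  then have "v (?j v \<otimes> u (?j u)) = \<one>" using vD by simp
  then show ?thesis using j uD vD vu by simp
qed

end

section \<open>The bilinear form on the twisted crossed product\<close>

locale crossed_product_frobenius =
  crossed_product_data K A G \<phi> \<alpha> + F: frobenius_form K A B
  for K and A and G and \<phi> and \<alpha> and B +
  fixes \<sigma>
  assumes nakayama: "nakayama_automorphism K A B \<sigma>"
begin

lemmas form = bilinear_formD[OF F.form]
lemmas form_assoc = associative_formD[OF F.assoc]

lemma nakayama_automorphism_\<sigma>: "algebra_automorphism K A \<sigma>"
  using nakayama by (simp add: nakayama_automorphism_def)

lemmas sigma = algebra_automorphismD[OF nakayama_automorphism_\<sigma>]

lemma form_sigma: "\<lbrakk>x \<in> carrier A; y \<in> carrier A\<rbrakk> \<Longrightarrow> B x y = B y (\<sigma> x)"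
  using nakayama by (simp add: nakayama_automorphism_def)

lemma action_automorphism: "g \<in> carrier G \<Longrightarrow> algebra_automorphism K A (\<phi> g)"
  using act by (simp add: acts_by_algebra_automorphisms_def)

lemma action_inv:
  assumes "g \<in> carrier G" "x \<in> carrier A"
  shows action_inv_left: "\<phi> (inv\<^bsub>G\<^esub> g) (\<phi> g x) = x"
    and action_inv_right: "\<phi> g (\<phi> (inv\<^bsub>G\<^esub> g) x) = x"
  using assms by (simp_all add: action_comp[symmetric] action_id)

abbreviation jac where "jac g \<equiv> nakayama_jacobian A B (\<phi> g)"

lemma jac_closed: "g \<in> carrier G \<Longrightarrow> jac g \<in> carrier A"
  by (simp add: F.nakayama_jacobian_closed action_automorphism)

lemma jac: "\<lbrakk>g \<in> carrier G; x \<in> carrier A; y \<in> carrier A\<rbrakk> \<Longrightarrow>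
    B (\<phi> g x) (\<phi> g y) = B (jac g \<otimes>\<^bsub>A\<^esub> x) y"
  by (simp add: F.nakayama_jacobian action_automorphism)

lemma jac_left_inverse:
  assumes "g \<in> carrier G"
  shows "\<phi> (inv\<^bsub>G\<^esub> g) (jac (inv\<^bsub>G\<^esub> g)) \<otimes>\<^bsub>A\<^esub> jac g = \<one>\<^bsub>A\<^esub>"
  by (rule F.nakayama_jacobian_left_inverse)
     (use assms in \<open>simp_all add: action_automorphism action_inv\<close>)

definition crossed_form where
  "crossed_form x y = B ((x \<otimes>\<^bsub>C\<^esub> y) \<one>\<^bsub>G\<^esub>) \<one>\<^bsub>A\<^esub>"

lemma bilinear_crossed_form: "bilinear_form K C crossed_form"
  by (auto simp: bilinear_form_def crossed_form_def mult_C C_app add_app smult_app form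
      l_distr_C r_distr_C smult_mult_left_C smult_mult_right_C)

lemma associative_crossed_form: "associative_form C crossed_form"
  by (auto simp: associative_form_def crossed_form_def mult_assoc_C)

lemma crossed_form_term_closed:
  "\<lbrakk>x \<in> carrier C; y \<in> carrier C; g \<in> carrier G\<rbrakk> \<Longrightarrow>
    \<alpha> g (inv\<^bsub>G\<^esub> g) \<otimes>\<^bsub>K\<^esub> B (x g) (\<phi> g (y (inv\<^bsub>G\<^esub> g))) \<in> carrier K"
  by (simp add: cocycle_closed form C_app action_closed)

text \<open>In the coefficient at the identity, position \<open>g\<close> of \<open>x\<close> meets
  only position \<open>inv g\<close> of \<open>y\<close>, and
  \<open>B (a \<otimes> b) \<one> = B a b\<close> by associativity.\<close>

lemma crossed_form_eq:
  assumes x: "x \<in> carrier C" and y: "y \<in> carrier C"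
  shows "crossed_form x y =
    (\<Oplus>\<^bsub>K\<^esub>g\<in>carrier G. \<alpha> g (inv\<^bsub>G\<^esub> g) \<otimes>\<^bsub>K\<^esub> B (x g) (\<phi> g (y (inv\<^bsub>G\<^esub> g))))"
proof -
  let ?t = "\<lambda>g. \<alpha> g (inv\<^bsub>G\<^esub> g \<otimes>\<^bsub>G\<^esub> \<one>\<^bsub>G\<^esub>) \<odot>\<^bsub>A\<^esub> (x g \<otimes>\<^bsub>A\<^esub> \<phi> g (y (inv\<^bsub>G\<^esub> g \<otimes>\<^bsub>G\<^esub> \<one>\<^bsub>G\<^esub>)))"
  have t: "?t \<in> carrier G \<rightarrow> carrier A" by (intro Pi_I term_closed x y) auto
  have "crossed_form x y = (\<Oplus>\<^bsub>K\<^esub>g\<in>carrier G. B (?t g) \<one>\<^bsub>A\<^esub>)"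
    unfolding crossed_form_def mult_app[OF G.one_closed]
    by (rule A.linear_functional_finsum[OF linear_functional_form_left[OF F.form A.A.one_closed] fin t])
  also have "\<dots> = (\<Oplus>\<^bsub>K\<^esub>g\<in>carrier G. \<alpha> g (inv\<^bsub>G\<^esub> g) \<otimes>\<^bsub>K\<^esub> B (x g) (\<phi> g (y (inv\<^bsub>G\<^esub> g))))"
    using x y
    by (intro A.R.finsum_cong')
       (auto simp: form form_assoc C_app action_closed cocycle_closed)
  finally show ?thesis .
qed

lemma monomial_app: "k \<in> carrier G \<Longrightarrow> monomial A G a g k = (if k = g then a else \<zero>\<^bsub>A\<^esub>)"
  by (simp add: monomial_def)

lemma form_zero: "x \<in> carrier A \<Longrightarrow> B x \<zero>\<^bsub>A\<^esub> = \<zero>\<^bsub>K\<^esub>" "x \<in> carrier A \<Longrightarrow> B \<zero>\<^bsub>A\<^esub> x = \<zero>\<^bsub>K\<^esub>"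
  using A.linear_functional_zero[OF linear_functional_form_right[OF F.form]]
    A.linear_functional_zero[OF linear_functional_form_left[OF F.form]] by auto

lemma crossed_form_monomial:
  assumes "a \<in> carrier A" "b \<in> carrier A" "g \<in> carrier G" "h \<in> carrier G"
  shows "crossed_form (monomial A G a g) (monomial A G b h) =
    \<alpha> g h \<otimes>\<^bsub>K\<^esub> B a (\<phi> g b) \<otimes>\<^bsub>K\<^esub> (if g \<otimes>\<^bsub>G\<^esub> h = \<one>\<^bsub>G\<^esub> then \<one>\<^bsub>K\<^esub> else \<zero>\<^bsub>K\<^esub>)"
  using assms
  by (simp add: crossed_form_def monomial_mult monomial_app form form_zero form_assoc
      action_closed cocycle_closed)

text \<open>Pairing with one monomial isolates one coefficient, which is how non-degeneracy passes
  from \<open>B\<close> to the new form. The monomial sits at \<open>inv g\<close> in order to meet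
  \<open>x g\<close>.\<close>

lemma crossed_form_monomial_right:
  assumes x: "x \<in> carrier C" and b: "b \<in> carrier A" and g: "g \<in> carrier G"
  shows "crossed_form x (monomial A G b (inv\<^bsub>G\<^esub> g)) = \<alpha> g (inv\<^bsub>G\<^esub> g) \<otimes>\<^bsub>K\<^esub> B (x g) (\<phi> g b)"
proof -
  let ?t = "\<alpha> g (inv\<^bsub>G\<^esub> g) \<otimes>\<^bsub>K\<^esub> B (x g) (\<phi> g b)"
  have t: "?t \<in> carrier K" using assms by (simp add: cocycle_closed form C_app action_closed)
  have "crossed_form x (monomial A G b (inv\<^bsub>G\<^esub> g)) = (\<Oplus>\<^bsub>K\<^esub>k\<in>carrier G. if g = k then ?t else \<zero>\<^bsub>K\<^esub>)"
    unfolding crossed_form_eq[OF x monomial_C[OF b]]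
    using assms t
    by (intro A.R.finsum_cong')
       (auto simp: monomial_app inj_on_eq_iff[OF G.inv_inj] action_zero form_zero C_app cocycle_closed)
  also have "\<dots> = ?t" using A.R.finsum_singleton[OF g fin, of "\<lambda>_. ?t"] t by simp
  finally show ?thesis .
qed

lemma crossed_form_monomial_left:
  assumes y: "y \<in> carrier C" and a: "a \<in> carrier A" and g: "g \<in> carrier G"
  shows "crossed_form (monomial A G a g) y = \<alpha> g (inv\<^bsub>G\<^esub> g) \<otimes>\<^bsub>K\<^esub> B a (\<phi> g (y (inv\<^bsub>G\<^esub> g)))"
proof -
  let ?t = "\<alpha> g (inv\<^bsub>G\<^esub> g) \<otimes>\<^bsub>K\<^esub> B a (\<phi> g (y (inv\<^bsub>G\<^esub> g)))"
  have t: "?t \<in> carrier K" using assms by (simp add: cocycle_closed form C_app action_closed)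
  have "crossed_form (monomial A G a g) y = (\<Oplus>\<^bsub>K\<^esub>k\<in>carrier G. if g = k then ?t else \<zero>\<^bsub>K\<^esub>)"
    unfolding crossed_form_eq[OF monomial_C[OF a] y]
    using assms t
    by (intro A.R.finsum_cong')
       (auto simp: monomial_app action_closed form_zero C_app cocycle_closed)
  also have "\<dots> = ?t" using A.R.finsum_singleton[OF g fin, of "\<lambda>_. ?t"] t by simp
  finally show ?thesis .
qed

lemma cocycle_mult_eq_zero:
  "\<lbrakk>g \<in> carrier G; h \<in> carrier G; c \<in> carrier K; \<alpha> g h \<otimes>\<^bsub>K\<^esub> c = \<zero>\<^bsub>K\<^esub>\<rbrakk> \<Longrightarrow> c = \<zero>\<^bsub>K\<^esub>"
  using A.R.Units_l_cancel[OF cocycle_unit, of g h c "\<zero>\<^bsub>K\<^esub>"] cocycle_closed by simp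

lemma nondegenerate_crossed_form: "nondegenerate_form K C crossed_form"
  unfolding nondegenerate_form_def
proof (intro conjI ballI impI)
  fix x assume x: "x \<in> carrier C" and zero: "\<forall>y\<in>carrier C. crossed_form x y = \<zero>\<^bsub>K\<^esub>"
  show "x = \<zero>\<^bsub>C\<^esub>"
  proof (rule C_ext[OF x zero_C])
    fix g assume g: "g \<in> carrier G"
    have xg: "x g \<in> carrier A" using x g by (rule C_app)
    have "B (x g) b = \<zero>\<^bsub>K\<^esub>" if b: "b \<in> carrier A" for b
    proof (rule cocycle_mult_eq_zero)
      \<comment> \<open>This choice makes \<open>\<phi> g\<close> of the monomial's coefficient
        equal to the arbitrary element \<open>b\<close>.\<close>
      let ?b = "\<phi> (inv\<^bsub>G\<^esub> g) b"
      have b': "?b \<in> carrier A" using b g by (simp add: action_closed)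
      show "\<alpha> g (inv\<^bsub>G\<^esub> g) \<otimes>\<^bsub>K\<^esub> B (x g) b = \<zero>\<^bsub>K\<^esub>"
        using crossed_form_monomial_right[OF x b' g] zero monomial_C[OF b'] b g
        by (simp add: action_inv)
    qed (use g b xg in \<open>auto simp: form\<close>)
    then show "x g = \<zero>\<^bsub>C\<^esub> g"
      using F.nondeg xg g by (simp add: nondegenerate_form_def zero_app)
  qed
next
  fix y assume y: "y \<in> carrier C" and zero: "\<forall>x\<in>carrier C. crossed_form x y = \<zero>\<^bsub>K\<^esub>"
  show "y = \<zero>\<^bsub>C\<^esub>"
  proof (rule C_ext[OF y zero_C])
    fix h assume h: "h \<in> carrier G"
    \<comment> \<open>A left monomial at \<open>g\<close> sees the coefficient of \<open>y\<close>
      at \<open>inv g\<close>, so \<open>g\<close> is chosen with inverse \<open>h\<close>. The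
      pairing sees \<open>y h\<close> through \<open>\<phi> ?g\<close>, which
      \<open>\<phi> h\<close> undoes at the end.\<close>
    let ?g = "inv\<^bsub>G\<^esub> h"
    have yh: "y h \<in> carrier A" using y h by (rule C_app)
    have "B a (\<phi> ?g (y h)) = \<zero>\<^bsub>K\<^esub>" if a: "a \<in> carrier A" for a
    proof (rule cocycle_mult_eq_zero)
      show "\<alpha> ?g (inv\<^bsub>G\<^esub> ?g) \<otimes>\<^bsub>K\<^esub> B a (\<phi> ?g (y h)) = \<zero>\<^bsub>K\<^esub>"
        using crossed_form_monomial_left[OF y a, of ?g] zero monomial_C[OF a] h by simp
    qed (use h a yh in \<open>auto simp: form action_closed\<close>)
    then have "\<phi> ?g (y h) = \<zero>\<^bsub>A\<^esub>"
      using F.nondeg yh h by (simp add: nondegenerate_form_def action_closed)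
    then have "y h = \<zero>\<^bsub>A\<^esub>" using action_inv_right[OF h yh] action_zero[OF h] by simp
    then show "y h = \<zero>\<^bsub>C\<^esub> h" using h by (simp add: zero_app)
  qed
qed

section \<open>The Nakayama automorphism of the twisted crossed product\<close>

definition crossed_nakayama_coeff where
  "crossed_nakayama_coeff g a =
    (\<alpha> g (inv\<^bsub>G\<^esub> g) \<otimes>\<^bsub>K\<^esub> inv\<^bsub>K\<^esub> (\<alpha> (inv\<^bsub>G\<^esub> g) g)) \<odot>\<^bsub>A\<^esub> (\<sigma> a \<otimes>\<^bsub>A\<^esub> \<phi> g (\<sigma> (jac g)))"

text \<open>The additive extension of the formula on monomials: \<Sigma> keeps each group element in
  place and so acts on every coefficient separately.\<close>

definition crossed_nakayama where
  "crossed_nakayama x = (\<lambda>g\<in>carrier G. crossed_nakayama_coeff g (x g))"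

lemma inv_cocycle:
  assumes "g \<in> carrier G" "h \<in> carrier G"
  shows inv_cocycle_closed: "inv\<^bsub>K\<^esub> (\<alpha> g h) \<in> carrier K"
    and inv_cocycle_right: "\<alpha> g h \<otimes>\<^bsub>K\<^esub> inv\<^bsub>K\<^esub> (\<alpha> g h) = \<one>\<^bsub>K\<^esub>"
  using cocycle_unit[OF assms] by auto

lemma crossed_nakayama_coeff_closed:
  "\<lbrakk>g \<in> carrier G; a \<in> carrier A\<rbrakk> \<Longrightarrow> crossed_nakayama_coeff g a \<in> carrier A"
  by (simp add: crossed_nakayama_coeff_def cocycle_closed inv_cocycle_closed action_closed sigma
      jac_closed)

lemma crossed_nakayama_closed: "x \<in> carrier C \<Longrightarrow> crossed_nakayama x \<in> carrier C"
  by (auto simp: carrier_C crossed_nakayama_def intro!: crossed_nakayama_coeff_closed)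

text \<open>The scalar-free core of the Nakayama identity. The outer \<open>\<phi> (inv g)\<close>
  is present because the coefficient of \<Sigma>\<open>(x)\<close> at \<open>g\<close> is paired
  with that of \<open>y\<close> at \<open>inv g\<close>.\<close>

lemma form_sigma_jac:
  assumes g: "g \<in> carrier G" and ab: "a \<in> carrier A" "b \<in> carrier A"
  shows "B b (\<phi> (inv\<^bsub>G\<^esub> g) (\<sigma> a \<otimes>\<^bsub>A\<^esub> \<phi> g (\<sigma> (jac g)))) = B a (\<phi> g b)"
proof -
  let ?a = "\<phi> (inv\<^bsub>G\<^esub> g) (\<sigma> a)"
  have a: "?a \<in> carrier A" "\<sigma> a \<in> carrier A" using g ab by (simp_all add: action_closed sigma)
  have j: "jac g \<in> carrier A" "\<sigma> (jac g) \<in> carrier A" using g by (simp_all add: jac_closed sigma)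
  have "B b (\<phi> (inv\<^bsub>G\<^esub> g) (\<sigma> a \<otimes>\<^bsub>A\<^esub> \<phi> g (\<sigma> (jac g)))) = B (b \<otimes>\<^bsub>A\<^esub> ?a) (\<sigma> (jac g))"
    using g a ab j by (simp add: action_mult action_closed action_inv form_assoc)
  also have "\<dots> = B (jac g) (b \<otimes>\<^bsub>A\<^esub> ?a)"
    using a ab j by (simp add: form_sigma[symmetric])
  \<comment> \<open>After reassociating to \<open>B (jac g \<otimes> b) ?a\<close>, this is the
    defining property of the Jacobian.\<close>
  also have "\<dots> = B (\<phi> g b) (\<phi> g ?a)"
    using g a ab j by (simp add: jac form_assoc)
  also have "\<dots> = B (\<phi> g b) (\<sigma> a)"
    using g a ab by (simp add: action_inv)
  also have "\<dots> = B a (\<phi> g b)"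
    using g ab by (simp add: form_sigma[symmetric] action_closed)
  finally show ?thesis .
qed

text \<open>Both sides are sums over the group that match after substituting \<open>inv g\<close>
  for \<open>g\<close>. The scalar in the formula is what this needs: its denominator cancels the
  cocycle value at \<open>(inv g, g)\<close>, and its numerator is the one at
  \<open>(g, inv g)\<close>.\<close>

lemma crossed_form_nakayama:
  assumes x: "x \<in> carrier C" and y: "y \<in> carrier C"
  shows "crossed_form x y = crossed_form y (crossed_nakayama x)"
proof -
  let ?t = "\<lambda>g. \<alpha> g (inv\<^bsub>G\<^esub> g) \<otimes>\<^bsub>K\<^esub> B (y g) (\<phi> g (crossed_nakayama x (inv\<^bsub>G\<^esub> g)))"
  have t: "?t g \<in> carrier K" if "g \<in> carrier G" for g
    by (rule crossed_form_term_closed[OF y crossed_nakayama_closed[OF x] that])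
  have inv: "m_inv G ` carrier G = carrier G"
  proof (intro equalityI subsetI)
    show "g \<in> m_inv G ` carrier G" if "g \<in> carrier G" for g
      using that by (intro image_eqI[of _ _ "inv\<^bsub>G\<^esub> g"]) simp_all
  qed auto
  have "crossed_form y (crossed_nakayama x) = (\<Oplus>\<^bsub>K\<^esub>g\<in>m_inv G ` carrier G. ?t g)"
    unfolding crossed_form_eq[OF y crossed_nakayama_closed[OF x]] inv ..
  also have "\<dots> = (\<Oplus>\<^bsub>K\<^esub>g\<in>carrier G. ?t (inv\<^bsub>G\<^esub> g))"
    by (rule A.R.finsum_reindex) (auto intro: t G.inv_inj)
  also have "\<dots> = crossed_form x y"
    unfolding crossed_form_eq[OF x y]
  proof (rule A.R.finsum_cong'[OF refl])
    show "(\<lambda>g. \<alpha> g (inv\<^bsub>G\<^esub> g) \<otimes>\<^bsub>K\<^esub> B (x g) (\<phi> g (y (inv\<^bsub>G\<^esub> g)))) \<in> carrier G \<rightarrow> carrier K"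
      by (intro Pi_I crossed_form_term_closed x y)
    fix g assume g: "g \<in> carrier G"
    let ?c = "\<alpha> g (inv\<^bsub>G\<^esub> g)" and ?d = "\<alpha> (inv\<^bsub>G\<^esub> g) g"
    have cd: "?c \<in> carrier K" "?d \<in> carrier K" "inv\<^bsub>K\<^esub> ?d \<in> carrier K" "?d \<otimes>\<^bsub>K\<^esub> inv\<^bsub>K\<^esub> ?d = \<one>\<^bsub>K\<^esub>"
      using g by (simp_all add: cocycle_closed inv_cocycle)
    have xy: "x g \<in> carrier A" "y (inv\<^bsub>G\<^esub> g) \<in> carrier A" using x y g by (simp_all add: C_app)
    let ?w = "\<sigma> (x g) \<otimes>\<^bsub>A\<^esub> \<phi> g (\<sigma> (jac g))" and ?b = "B (x g) (\<phi> g (y (inv\<^bsub>G\<^esub> g)))"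
    have w: "?w \<in> carrier A" using g xy by (simp add: sigma action_closed jac_closed)
    have b: "?b \<in> carrier K" using g xy by (simp add: form action_closed)
    have "?t (inv\<^bsub>G\<^esub> g) = ?d \<otimes>\<^bsub>K\<^esub> B (y (inv\<^bsub>G\<^esub> g)) (\<phi> (inv\<^bsub>G\<^esub> g) ((?c \<otimes>\<^bsub>K\<^esub> inv\<^bsub>K\<^esub> ?d) \<odot>\<^bsub>A\<^esub> ?w))"
      using g by (simp add: crossed_nakayama_def crossed_nakayama_coeff_def)
    also have "\<dots> = ?d \<otimes>\<^bsub>K\<^esub> ((?c \<otimes>\<^bsub>K\<^esub> inv\<^bsub>K\<^esub> ?d) \<otimes>\<^bsub>K\<^esub> ?b)"
      using g xy w cd form_sigma_jac[OF g xy] by (simp add: action_smult action_closed form)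
    \<comment> \<open>Only closure facts are passed here, so the rewriting merely reorders factors;
      the cancellation of \<open>?d\<close> follows.\<close>
    also have "\<dots> = (?d \<otimes>\<^bsub>K\<^esub> inv\<^bsub>K\<^esub> ?d) \<otimes>\<^bsub>K\<^esub> (?c \<otimes>\<^bsub>K\<^esub> ?b)"
      using cd(1-3) b by (simp add: A.R.m_ac)
    also have "\<dots> = ?c \<otimes>\<^bsub>K\<^esub> ?b"
      using cd b by simp
    finally show "?t (inv\<^bsub>G\<^esub> g) = ?c \<otimes>\<^bsub>K\<^esub> ?b" .
  qed
  finally show ?thesis ..
qed

text \<open>Apart from \<sigma> and a unit scalar, the map is right multiplication by
  \<open>?s\<close>. A left inverse \<open>?r\<close> of \<open>?s\<close> gives
  \<open>b \<otimes> ?r\<close> as preimage of \<open>b\<close> under this multiplication, and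
  surjectivity of \<sigma> does the rest.\<close>

lemma crossed_nakayama_coeff_surj:
  assumes g: "g \<in> carrier G" and b: "b \<in> carrier A"
  shows "\<exists>a\<in>carrier A. crossed_nakayama_coeff g a = b"
proof -
  let ?c = "\<alpha> g (inv\<^bsub>G\<^esub> g)" and ?d = "\<alpha> (inv\<^bsub>G\<^esub> g) g"
  let ?i = "\<phi> (inv\<^bsub>G\<^esub> g) (jac (inv\<^bsub>G\<^esub> g))"
  let ?r = "\<phi> g (\<sigma> ?i)" and ?s = "\<phi> g (\<sigma> (jac g))"
  have cd: "?c \<in> carrier K" "?d \<in> carrier K" "inv\<^bsub>K\<^esub> ?c \<in> carrier K" "inv\<^bsub>K\<^esub> ?d \<in> carrier K"
    "?d \<otimes>\<^bsub>K\<^esub> inv\<^bsub>K\<^esub> ?d = \<one>\<^bsub>K\<^esub>" "?c \<otimes>\<^bsub>K\<^esub> inv\<^bsub>K\<^esub> ?c = \<one>\<^bsub>K\<^esub>"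
    using g by (simp_all add: cocycle_closed inv_cocycle)
  have i: "?i \<in> carrier A" "jac g \<in> carrier A" using g by (simp_all add: jac_closed action_closed)
  have rs: "?r \<in> carrier A" "?s \<in> carrier A" using g i by (simp_all add: action_closed sigma)
  \<comment> \<open>\<open>?r\<close> is the image of the left inverse of \<open>jac g\<close> under
    \<sigma> followed by \<open>\<phi> g\<close>, both multiplicative and unital.\<close>
  have "?r \<otimes>\<^bsub>A\<^esub> ?s = \<phi> g (\<sigma> (?i \<otimes>\<^bsub>A\<^esub> jac g))"
    using g i by (simp add: action_mult sigma)
  then have one: "?r \<otimes>\<^bsub>A\<^esub> ?s = \<one>\<^bsub>A\<^esub>"
    using g by (simp add: jac_left_inverse sigma action_one)
  \<comment> \<open>The inverse of the scalar in \<open>crossed_nakayama_coeff\<close>.\<close>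
  let ?e = "?d \<otimes>\<^bsub>K\<^esub> inv\<^bsub>K\<^esub> ?c"
  have "?e \<odot>\<^bsub>A\<^esub> (b \<otimes>\<^bsub>A\<^esub> ?r) \<in> \<sigma> ` carrier A"
    unfolding sigma(6) using cd b rs by simp
  then obtain a where a: "a \<in> carrier A" "\<sigma> a = ?e \<odot>\<^bsub>A\<^esub> (b \<otimes>\<^bsub>A\<^esub> ?r)" by auto
  have "?c \<otimes>\<^bsub>K\<^esub> inv\<^bsub>K\<^esub> ?d \<otimes>\<^bsub>K\<^esub> ?e = (?c \<otimes>\<^bsub>K\<^esub> inv\<^bsub>K\<^esub> ?c) \<otimes>\<^bsub>K\<^esub> (?d \<otimes>\<^bsub>K\<^esub> inv\<^bsub>K\<^esub> ?d)"
    using cd(1-4) by (simp add: A.R.m_ac)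
  then have e: "?c \<otimes>\<^bsub>K\<^esub> inv\<^bsub>K\<^esub> ?d \<otimes>\<^bsub>K\<^esub> ?e = \<one>\<^bsub>K\<^esub>" using cd by simp
  have "\<sigma> a \<otimes>\<^bsub>A\<^esub> ?s = ?e \<odot>\<^bsub>A\<^esub> b"
    unfolding a(2) using cd b rs one by (simp add: A.smult_mult_left A.A.m_assoc)
  then have "crossed_nakayama_coeff g a = (?c \<otimes>\<^bsub>K\<^esub> inv\<^bsub>K\<^esub> ?d \<otimes>\<^bsub>K\<^esub> ?e) \<odot>\<^bsub>A\<^esub> b"
    unfolding crossed_nakayama_coeff_def using cd(1-4) b
    by (simp add: A.smult_assoc1[symmetric])
  then show ?thesis unfolding e using a(1) b by auto
qed

lemma crossed_nakayama_image: "crossed_nakayama ` carrier C = carrier C"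
proof (intro equalityI subsetI)
  fix y assume y: "y \<in> carrier C"
  \<comment> \<open>A preimage is assembled by choosing one for each coefficient; the membership
    condition is moved inside so that choice applies over the whole type.\<close>
  have "\<forall>g. \<exists>a. g \<in> carrier G \<longrightarrow> a \<in> carrier A \<and> crossed_nakayama_coeff g a = y g"
    using crossed_nakayama_coeff_surj C_app[OF y] by meson
  then obtain f where f: "\<And>g. g \<in> carrier G \<Longrightarrow> f g \<in> carrier A \<and> crossed_nakayama_coeff g (f g) = y g"
    by metis
  have x: "restrict f (carrier G) \<in> carrier C" using f by (auto simp: carrier_C)
  moreover have "y = crossed_nakayama (restrict f (carrier G))"
    by (rule C_ext[OF y crossed_nakayama_closed[OF x]]) (simp add: crossed_nakayama_def f)
  ultimately show "y \<in> crossed_nakayama ` carrier C" by blast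
qed (auto intro: crossed_nakayama_closed)

lemma nakayama_crossed_nakayama: "nakayama_automorphism K C crossed_form crossed_nakayama"
proof (rule assoc_algebra.nakayama_automorphismI[OF assoc_algebra_C])
  show "crossed_form x y = crossed_form y (crossed_nakayama x)"
    if "x \<in> carrier C" "y \<in> carrier C" for x y
    using that by (rule crossed_form_nakayama)
qed (rule bilinear_crossed_form nondegenerate_crossed_form associative_crossed_form
    crossed_nakayama_image)+

lemma crossed_nakayama_monomial:
  assumes "a \<in> carrier A" "g \<in> carrier G"
  shows "crossed_nakayama (monomial A G a g) = monomial A G (crossed_nakayama_coeff g a) g"
proof (rule C_ext)
  fix k assume k: "k \<in> carrier G"
  \<comment> \<open>Away from \<open>g\<close> the coefficient of the monomial is zero and has to
    stay zero.\<close>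
  have "crossed_nakayama_coeff k \<zero>\<^bsub>A\<^esub> = \<zero>\<^bsub>A\<^esub>"
  proof -
    have "\<sigma> \<zero>\<^bsub>A\<^esub> = \<zero>\<^bsub>A\<^esub>"
      using sigma(5)[of "\<zero>\<^bsub>K\<^esub>" "\<zero>\<^bsub>A\<^esub>"] sigma(1)[of "\<zero>\<^bsub>A\<^esub>"] by simp
    then show ?thesis
      using k by (simp add: crossed_nakayama_coeff_def cocycle_closed inv_cocycle_closed
          action_closed sigma jac_closed)
  qed
  then show "crossed_nakayama (monomial A G a g) k = monomial A G (crossed_nakayama_coeff g a) g k"
    using k by (simp add: crossed_nakayama_def monomial_app)
qed (use assms in \<open>auto intro!: monomial_C crossed_nakayama_closed crossed_nakayama_coeff_closed\<close>)

text \<open>Transfers the formula from the constructed map to every Nakayama automorphism of the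
  form, since all of them agree on the carrier.\<close>

lemma crossed_nakayama_unique:
  assumes "nakayama_automorphism K C crossed_form \<Sigma>" "a \<in> carrier A" "g \<in> carrier G"
  shows "\<Sigma> (monomial A G a g) = monomial A G (crossed_nakayama_coeff g a) g"
  using assoc_algebra.nakayama_automorphism_unique[OF assoc_algebra_C bilinear_crossed_form
      nondegenerate_crossed_form assms(1) nakayama_crossed_nakayama monomial_C[OF assms(2)]]
    crossed_nakayama_monomial[OF assms(2,3)] by simp

end

theorem lemma36:
  fixes K :: "('k, 'm) ring_scheme"
    and A :: "('k, 'a, 'n) module_scheme"
    and B :: "'a \<Rightarrow> 'a \<Rightarrow> 'k"
    and \<sigma> :: "'a \<Rightarrow> 'a"
    and G :: "('g, 'p) monoid_scheme"
    and \<phi> :: "'g \<Rightarrow> 'a \<Rightarrow> 'a"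
    and \<alpha> :: "'g \<Rightarrow> 'g \<Rightarrow> 'k"
  assumes "frobenius_algebra K A B"
    and "nakayama_automorphism K A B \<sigma>"
    and "group G" and "finite (carrier G)"
    and "acts_by_algebra_automorphisms K A G \<phi>"
    and "two_cocycle K G \<alpha>"
  defines "C \<equiv> twisted_crossed_product K A G \<phi> \<alpha>"
  shows "\<exists>BB. bilinear_form K C BB \<and> nondegenerate_form K C BB \<and> associative_form C BB \<and>
    (\<forall>a\<in>carrier A. \<forall>b\<in>carrier A. \<forall>g\<in>carrier G. \<forall>h\<in>carrier G.
       BB (monomial A G a g) (monomial A G b h) =
         \<alpha> g h \<otimes>\<^bsub>K\<^esub> B a (\<phi> g b) \<otimes>\<^bsub>K\<^esub>
           (if g \<otimes>\<^bsub>G\<^esub> h = \<one>\<^bsub>G\<^esub> then \<one>\<^bsub>K\<^esub> else \<zero>\<^bsub>K\<^esub>)) \<and>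
    (\<exists>\<Sigma>. nakayama_automorphism K C BB \<Sigma>) \<and>
    (\<forall>\<Sigma>. nakayama_automorphism K C BB \<Sigma> \<longrightarrow>
       (\<forall>a\<in>carrier A. \<forall>g\<in>carrier G.
          \<Sigma> (monomial A G a g) =
            monomial A G
              ((\<alpha> g (inv\<^bsub>G\<^esub> g) \<otimes>\<^bsub>K\<^esub> inv\<^bsub>K\<^esub> (\<alpha> (inv\<^bsub>G\<^esub> g) g)) \<odot>\<^bsub>A\<^esub>
                (\<sigma> a \<otimes>\<^bsub>A\<^esub> \<phi> g (\<sigma> (nakayama_jacobian A B (\<phi> g))))) g))"
proof -
  interpret A: assoc_algebra K A using assms(1) by (simp add: frobenius_algebra_def)
  interpret G: group G by (rule assms(3))
  interpret crossed_product_frobenius K A G \<phi> \<alpha> B \<sigma>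
    using assms(1-6) by unfold_locales
  show ?thesis
    unfolding C_def
  \<comment> \<open>Existence of \<Sigma> is witnessed by \<open>crossed_nakayama\<close>; the
    formula for an arbitrary \<Sigma> comes from uniqueness.\<close>
  proof (intro exI[of _ crossed_form] conjI ballI allI impI)
    show "\<exists>\<Sigma>. nakayama_automorphism K (twisted_crossed_product K A G \<phi> \<alpha>) crossed_form \<Sigma>"
      by (rule exI[of _ crossed_nakayama]) (rule nakayama_crossed_nakayama)
  qed (rule bilinear_crossed_form nondegenerate_crossed_form associative_crossed_form
      crossed_form_monomial crossed_nakayama_unique[unfolded crossed_nakayama_coeff_def];
      assumption)+
qed

end
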